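(* Let $\{f_t:t\in\mathbb{N}\}$ be a countably infinite set of scaling functions totally ordered by domination. For each $t\in\mathbb{N}$ let $\Xi_t$ be any scale limit. Let $\Gamma$ be any permuton and $\Lambda$ any permutation local limit. Then there exists a sequence of permutations $(\tau_m)_{m\in\mathbb{N}}$ with $|\tau_m|\to\infty$ which converges to $\Xi_t$ at scale $f_t$ for every $t\in\mathbb{N}$, converges globally to $\Gamma$, and converges locally to $\Lambda$.
   Context: For $g,h:\mathbb{N}\to\mathbb{R}^+$ write $g\ll h$ if $g(n)/h(n)\to0$. A scaling function is a function $f:\mathbb{N}\to\mathbb{R}^+$ with $f(n)\le n$ for all $n$, $f(n)\to\infty$ and $f(n)/n\to 0$. A set of scaling functions is totally ordered by domination if for every two distinct members $f,g$ either $f\ll g$ or $g\ll f$. Let $S_n$ be the set of permutations of $[n]$ and $S=\bigcup_nS_n$. An occurrence of $\pi\in S_k$ in $\sigma\in S_n$ is a set of indices $i_1<\dots<i_k$ with $\sigma(i_1)\dots\sigma(i_k)$ order-isomorphic to $\pi$; its width is $i_k-i_1+1$. For real $f\in[k,n]$, $\rho_f(\pi,\sigma)$ is the number of occurrences of $\pi$ in $\sigma$ of width at most $f$ divided by the number of $k$-subsets of $[n]$ of width at most $f$; the global density is $\rho(\pi,\sigma)=\rho_n(\pi,\sigma)$ and the local density is $\rho_k(\pi,\sigma)$ (consecutive occurrences). A sequence $(\sigma_j)$ with $|\sigma_j|\to\infty$ converges at scale $f$ to $\Xi\in[0,1]^S$ if $\rho_{f(|\sigma_j|)}(\pi,\sigma_j)\to\Xi_\pi$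 for all $\pi\in S$; a scale limit is a $\Xi$ arising in this way for some scaling function and some sequence. The sequence converges locally to $\Lambda\in[0,1]^S$ if $\rho_{|\pi|}(\pi,\sigma_j)\to\Lambda_\pi$ for all $\pi$; a permutation local limit is a $\Lambda$ arising in this way. A permuton is a Borel probability measure $\Gamma$ on $[0,1]^2$ with uniform marginals; $\rho(\pi,\Gamma)$ is the probability that $k=|\pi|$ independent $\Gamma$-distributed points, listed in increasing order of $x$-coordinate, have $y$-coordinates order-isomorphic to $\pi$. The sequence converges globally to $\Gamma$ if $\rho(\pi,\sigma_j)\to\rho(\pi,\Gamma)$ for all $\pi$. *)

theory Defs
  imports "HOL-Probability.Probability"
begin

text \<open>Permutations of [n] are represented as lists over {0..<n} (0-based):
  a permutation sigma of length n is a list whose entries are exactly 0,...,n-1.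
  S is the set of all nonempty permutations (n >= 1).\<close>

definition is_perm :: "nat list \<Rightarrow> bool" where
  "is_perm \<sigma> \<longleftrightarrow> distinct \<sigma> \<and> set \<sigma> = {0..<length \<sigma>}"

definition PermS :: "nat list set" where
  "PermS = {\<pi>. is_perm \<pi> \<and> length \<pi> \<ge> 1}"

definition std :: "nat list \<Rightarrow> nat list" where
  "std vs = map (\<lambda>v. card {w \<in> set vs. w < v}) vs"

definition pat_at :: "nat list \<Rightarrow> nat set \<Rightarrow> nat list" where
  "pat_at \<sigma> I = std (map (\<lambda>i. \<sigma> ! i) (sorted_list_of_set I))"

definition width :: "nat set \<Rightarrow> nat" where
  "width I = Max I - Min I + 1"

definition windows :: "real \<Rightarrow> nat \<Rightarrow> nat \<Rightarrow> nat set set" where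
  "windows f k n = {I. I \<subseteq> {0..<n} \<and> card I = k \<and> real (width I) \<le> f}"

definition rho :: "real \<Rightarrow> nat list \<Rightarrow> nat list \<Rightarrow> real" where
  "rho f \<pi> \<sigma> =
     real (card {I \<in> windows f (length \<pi>) (length \<sigma>). pat_at \<sigma> I = \<pi>})
     / real (card (windows f (length \<pi>) (length \<sigma>)))"

definition global_density :: "nat list \<Rightarrow> nat list \<Rightarrow> real" where
  "global_density \<pi> \<sigma> = rho (real (length \<sigma>)) \<pi> \<sigma>"

definition local_density :: "nat list \<Rightarrow> nat list \<Rightarrow> real" where
  "local_density \<pi> \<sigma> = rho (real (length \<pi>)) \<pi> \<sigma>"

definition dominated :: "(nat \<Rightarrow> real) \<Rightarrow> (nat \<Rightarrow> real) \<Rightarrow> bool" where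
  "dominated g h \<longleftrightarrow> ((\<lambda>n. g n / h n) \<longlonglongrightarrow> 0)"

text \<open>Scaling functions; the natural numbers start at 1 here (f(n) <= n with f(n) > 0).\<close>
definition scaling_function :: "(nat \<Rightarrow> real) \<Rightarrow> bool" where
  "scaling_function f \<longleftrightarrow>
     (\<forall>n\<ge>1. 0 < f n \<and> f n \<le> real n) \<and>
     filterlim f at_top sequentially \<and>
     ((\<lambda>n. f n / real n) \<longlonglongrightarrow> 0)"

definition perm_sequence :: "(nat \<Rightarrow> nat list) \<Rightarrow> bool" where
  "perm_sequence \<sigma> \<longleftrightarrow> (\<forall>j. is_perm (\<sigma> j)) \<and>
     filterlim (\<lambda>j. length (\<sigma> j)) at_top sequentially"

definition converges_at_scale ::
    "(nat \<Rightarrow> real) \<Rightarrow> (nat \<Rightarrow> nat list) \<Rightarrow> (nat list \<Rightarrow> real) \<Rightarrow> bool" where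
  "converges_at_scale f \<sigma> \<Xi> \<longleftrightarrow>
     (\<forall>\<pi>\<in>PermS. (\<lambda>j. rho (f (length (\<sigma> j))) \<pi> (\<sigma> j)) \<longlonglongrightarrow> \<Xi> \<pi>)"

definition scale_limit :: "(nat list \<Rightarrow> real) \<Rightarrow> bool" where
  "scale_limit \<Xi> \<longleftrightarrow>
     (\<exists>f \<sigma>. scaling_function f \<and> perm_sequence \<sigma> \<and> converges_at_scale f \<sigma> \<Xi>)"

definition converges_locally :: "(nat \<Rightarrow> nat list) \<Rightarrow> (nat list \<Rightarrow> real) \<Rightarrow> bool" where
  "converges_locally \<sigma> \<Lambda> \<longleftrightarrow>
     (\<forall>\<pi>\<in>PermS. (\<lambda>j. local_density \<pi> (\<sigma> j)) \<longlonglongrightarrow> \<Lambda> \<pi>)"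

definition perm_local_limit :: "(nat list \<Rightarrow> real) \<Rightarrow> bool" where
  "perm_local_limit \<Lambda> \<longleftrightarrow> (\<exists>\<sigma>. perm_sequence \<sigma> \<and> converges_locally \<sigma> \<Lambda>)"

text \<open>Permutons: Borel probability measures on the plane with uniform marginals on [0,1]
  (hence concentrated on the unit square).\<close>
definition permuton :: "(real \<times> real) measure \<Rightarrow> bool" where
  "permuton \<Gamma> \<longleftrightarrow> prob_space \<Gamma> \<and> sets \<Gamma> = sets borel \<and>
     distr \<Gamma> borel fst = uniform_measure lborel {0..1} \<and>
     distr \<Gamma> borel snd = uniform_measure lborel {0..1}"

text \<open>The event that k points p 0,...,p (k-1), listed in increasing order of x-coordinate
  (via the reordering s), have y-coordinates order-isomorphic to pi.  Ties in x have
  probability zero and are excluded.\<close>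
definition pattern_event :: "nat list \<Rightarrow> (nat \<Rightarrow> real \<times> real) set" where
  "pattern_event \<pi> = {p. \<exists>s. (\<forall>a<length \<pi>. s a < length \<pi>) \<and>
      (\<forall>a<length \<pi>. \<forall>b<length \<pi>.
         (a < b \<longrightarrow> fst (p (s a)) < fst (p (s b))) \<and>
         (snd (p (s a)) < snd (p (s b)) \<longleftrightarrow> \<pi> ! a < \<pi> ! b))}"

definition permuton_density :: "nat list \<Rightarrow> (real \<times> real) measure \<Rightarrow> real" where
  "permuton_density \<pi> \<Gamma> =
     measure (PiM {0..<length \<pi>} (\<lambda>_. \<Gamma>))
       (pattern_event \<pi> \<inter> space (PiM {0..<length \<pi>} (\<lambda>_. \<Gamma>)))"

definition converges_globally :: "(nat \<Rightarrow> nat list) \<Rightarrow> (real \<times> real) measure \<Rightarrow> bool" where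
  "converges_globally \<sigma> \<Gamma> \<longleftrightarrow>
     (\<forall>\<pi>\<in>PermS. (\<lambda>j. global_density \<pi> (\<sigma> j)) \<longlonglongrightarrow> permuton_density \<pi> \<Gamma>)"

end

theory Submission
  imports Defs
begin

text \<open>
  A permutation of length \<open>n\<close> is built from finitely many levels, one for each scale, by
  comparing positions lexicographically, coarse levels first. A level of scale \<open>f\<close>, whose
  target is approximated by a fixed permutation \<open>\<sigma>\<close> with windows of width \<open>w\<close>, cuts the
  positions into blocks of length about \<open>f(n) / w\<close> and orders the blocks like an infinite
  direct sum of copies of \<open>\<sigma>\<close>. A typical window of width at most \<open>f(n)\<close> crosses no block
  boundary of any coarser level, so all coarser levels are tied on it; it meets every block of
  its own level at most once, so the finer levels are irrelevant; and it lies inside a single copy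
  of \<open>\<sigma>\<close>. Hence its pattern is distributed almost like that of a window of width \<open>w\<close> in \<open>\<sigma>\<close>.
  The local limit is the level with blocks of length 1, and the permuton is the coarsest level,
  where \<open>\<sigma>\<close> is obtained by sampling points and bounding the second moment of the pattern
  densities. A diagonal choice over more and more levels and patterns gives the sequence.
\<close>

subsection \<open>Patterns and windows\<close>

text \<open>Three kinds of windows are lost when a fixed \<open>\<sigma>\<close> is used as a level,
  and each loss has its own remedy. Windows that cross a block boundary of a coarser level become
  rare as n grows: \<open>\<sigma>\<close> and \<open>w\<close> are fixed, so the coarser block
  length exceeds any multiple of the finer f(n). Windows with two points in one block have a
  limiting proportion of order k^2 / w, so \<open>w\<close> must be large. Windows that straddle two
  copies of \<open>\<sigma>\<close> have a limiting proportion of order w / |\<sigma>|, so this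
  ratio must be small. A scale limit supplies both, since along its defining sequence f tends to
  infinity and f(n) / n to 0. Nothing else about the scaling function behind \<Xi>_t is retained,
  which is why \<Xi>_t can be realised at the unrelated scale f_t. The two extreme levels each avoid
  one loss: blocks of length 1 cannot hold two points, and a single copy of \<open>\<sigma>\<close>
  has no neighbour. The order of choices is forced: patterns, tolerance and finitely many scales,
  next the permutations \<open>\<sigma>\<close> and the widths \<open>w\<close>, last n.\<close>

lemma std_nth:
  assumes "distinct vs" "a < length vs"
  shows "std vs ! a = card {c. c < length vs \<and> vs ! c < vs ! a}"
proof -
  have "{w \<in> set vs. w < vs ! a} = (!) vs ` {c. c < length vs \<and> vs ! c < vs ! a}"
    by (auto simp: in_set_conv_nth)
  moreover have "inj_on ((!) vs) {c. c < length vs \<and> vs ! c < vs ! a}"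
    using assms(1) by (auto simp: inj_on_def nth_eq_iff_index_eq)
  ultimately show ?thesis
    using assms(2) by (simp add: std_def card_image)
qed

lemma std_nth_less_iff:
  assumes "distinct vs" "a < length vs" "b < length vs"
  shows "std vs ! a < std vs ! b \<longleftrightarrow> vs ! a < vs ! b"
proof -
  have *: "std vs ! a < std vs ! b" if "a < length vs" "b < length vs" "vs ! a < vs ! b" for a b
    unfolding std_nth[OF assms(1) that(1)] std_nth[OF assms(1) that(2)]
    by (rule psubset_card_mono) (use that in auto)
  show ?thesis
    using *[of a b] *[of b a] assms
    by (cases "vs ! a" "vs ! b" rule: linorder_cases) (auto simp: nth_eq_iff_index_eq)
qed

lemma length_std [simp]: "length (std vs) = length vs"
  by (simp add: std_def)

lemma is_perm_std:
  assumes "distinct vs"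
  shows "is_perm (std vs)"
proof -
  have "distinct (std vs)"
    unfolding distinct_conv_nth
  proof (intro allI impI)
    fix a b assume "a < length (std vs)" "b < length (std vs)" "a \<noteq> b"
    then have "a < length vs" "b < length vs" "vs ! a \<noteq> vs ! b"
      using assms by (auto simp: nth_eq_iff_index_eq)
    then show "std vs ! a \<noteq> std vs ! b"
      using std_nth_less_iff[OF assms, of a b] std_nth_less_iff[OF assms, of b a] by auto
  qed
  moreover have "set (std vs) \<subseteq> {0..<length vs}"
  proof
    fix x assume "x \<in> set (std vs)"
    then obtain a where "a < length (std vs)" "std vs ! a = x" unfolding in_set_conv_nth by blast
    then have a: "a < length vs" "x = std vs ! a" by simp_all
    have "{c. c < length vs \<and> vs ! c < vs ! a} \<subseteq> {0..<length vs} - {a}" by auto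
    from card_mono[OF _ this] show "x \<in> {0..<length vs}"
      using a std_nth[OF assms a(1)] by simp
  qed
  ultimately show ?thesis
    unfolding is_perm_def by (simp add: card_subset_eq distinct_card)
qed

lemma std_is_perm:
  assumes "is_perm \<pi>"
  shows "std \<pi> = \<pi>"
proof (rule nth_equalityI)
  fix a assume "a < length (std \<pi>)"
  then have a: "a < length \<pi>" by simp
  then have "\<pi> ! a < length \<pi>" using assms nth_mem[of a \<pi>] unfolding is_perm_def by fastforce
  then have "{w \<in> set \<pi>. w < \<pi> ! a} = {0..<\<pi> ! a}"
    using assms unfolding is_perm_def by auto
  then show "std \<pi> ! a = \<pi> ! a" using a by (simp add: std_def)
qed simp

lemma std_cong_order:
  assumes "distinct vs" "distinct us" "length us = length vs"
    and "\<And>a b. a < length vs \<Longrightarrow> b < length vs \<Longrightarrow> us ! a < us ! b \<longleftrightarrow> vs ! a < vs ! b"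
  shows "std us = std vs"
proof (rule nth_equalityI)
  fix a assume "a < length (std us)"
  then have "a < length us" by simp
  then show "std us ! a = std vs ! a"
    using assms by (auto simp: std_nth intro!: arg_cong[of _ _ card])
qed (use assms in auto)

lemma std_eq_iff:
  assumes "distinct vs" "is_perm \<pi>" "length \<pi> = length vs"
  shows "std vs = \<pi> \<longleftrightarrow> (\<forall>a<length \<pi>. \<forall>b<length \<pi>. vs ! a < vs ! b \<longleftrightarrow> \<pi> ! a < \<pi> ! b)"
proof
  assume "std vs = \<pi>"
  then show "\<forall>a<length \<pi>. \<forall>b<length \<pi>. vs ! a < vs ! b \<longleftrightarrow> \<pi> ! a < \<pi> ! b"
    using std_nth_less_iff[OF assms(1)] by auto
next
  assume "\<forall>a<length \<pi>. \<forall>b<length \<pi>. vs ! a < vs ! b \<longleftrightarrow> \<pi> ! a < \<pi> ! b"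
  then have "std vs = std \<pi>"
    using assms by (intro std_cong_order) (simp_all add: is_perm_def)
  then show "std vs = \<pi>" using std_is_perm[OF assms(2)] by simp
qed

text \<open>\<open>pat_at\<close> reads values from a list, whereas a blow-up is a function on all
  naturals that may repeat values. Patterns are therefore taken of arbitrary functions; they are
  used where the function is injective on \<open>I\<close>.\<close>

definition pat :: "(nat \<Rightarrow> nat) \<Rightarrow> nat set \<Rightarrow> nat list" where
  "pat u I = std (map u (sorted_list_of_set I))"

lemma pat_at_eq_pat: "pat_at \<sigma> I = pat ((!) \<sigma>) I"
  by (simp add: pat_at_def pat_def)

lemma pat_cong_order:
  assumes "finite I" "inj_on u I" "inj_on v I"
    and "\<And>i j. i \<in> I \<Longrightarrow> j \<in> I \<Longrightarrow> u i < u j \<longleftrightarrow> v i < v j"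
  shows "pat u I = pat v I"
  unfolding pat_def
proof (rule std_cong_order)
  show "distinct (map v (sorted_list_of_set I))" "distinct (map u (sorted_list_of_set I))"
    using assms by (simp_all add: distinct_map)
next
  fix a b assume "a < length (map v (sorted_list_of_set I))" "b < length (map v (sorted_list_of_set I))"
  then show "map u (sorted_list_of_set I) ! a < map u (sorted_list_of_set I) ! b \<longleftrightarrow>
        map v (sorted_list_of_set I) ! a < map v (sorted_list_of_set I) ! b"
    using assms(4)[of "sorted_list_of_set I ! a" "sorted_list_of_set I ! b"]
      nth_mem[of _ "sorted_list_of_set I"] assms(1) by simp
qed simp

lemma pat_image:
  assumes "finite B" "strict_mono_on B h"
  shows "pat u (h ` B) = pat (u \<circ> h) B"
proof -
  have "sorted_list_of_set (h ` B) = map h (sorted_list_of_set B)"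
  proof (rule sorted_distinct_set_unique)
    show "sorted (map h (sorted_list_of_set B))"
      unfolding sorted_map
      by (rule sorted_wrt_mono_rel[OF _ sorted_sorted_list_of_set[of B]])
        (use assms in \<open>auto simp: strict_mono_on_leD\<close>)
    show "distinct (map h (sorted_list_of_set B))"
      using assms by (simp add: distinct_map strict_mono_on_imp_inj_on)
  qed (use assms in auto)
  then show ?thesis by (simp add: pat_def)
qed

section \<open>Counting windows of bounded width\<close>

lemma windows_of_nat:
  "windows (real m) k n = {I. I \<subseteq> {0..<n} \<and> card I = k \<and> width I \<le> m}"
  by (simp add: windows_def)

lemma finite_windows [simp, intro]: "finite (windows f k n)"
  by (rule finite_subset[of _ "Pow {0..<n}"]) (auto simp: windows_def)

lemma windows_floor:
  assumes "0 \<le> f"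
  shows "windows f k n = windows (real (nat \<lfloor>f\<rfloor>)) k n"
proof -
  have "real v \<le> f \<longleftrightarrow> real v \<le> real (nat \<lfloor>f\<rfloor>)" for v :: nat
    using assms by (metis le_nat_floor of_nat_le_iff of_nat_floor order_trans)
  then show ?thesis by (auto simp: windows_def)
qed

lemma rho_floor: "0 \<le> f \<Longrightarrow> rho f \<pi> \<sigma> = rho (real (nat \<lfloor>f\<rfloor>)) \<pi> \<sigma>"
  unfolding rho_def by (subst (1 2) windows_floor) auto

text \<open>A window of width at most m is its minimum together with k - 1 of the next m - 1
  positions. This encoding gives an upper and a lower bound for the number of windows, which differ
  only in the minima too close to the right end.\<close>

lemma windows_Min_decomp:
  assumes "I \<in> windows (real m) k n" "k \<ge> 1"
  obtains J where "I = insert (Min I) J" "J \<subseteq> {Min I + 1..<Min I + m}" "card J = k - 1"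
proof -
  have I: "I \<subseteq> {0..<n}" "card I = k" "Max I - Min I + 1 \<le> m"
    using assms by (auto simp: windows_of_nat width_def)
  have fin: "finite I" and ne: "I \<noteq> {}" using I assms(2) finite_subset by auto
  have "I - {Min I} \<subseteq> {Min I + 1..<Min I + m}"
  proof
    fix i assume i: "i \<in> I - {Min I}"
    then have "Min I \<le> i" "i \<le> Max I" using fin by auto
    then show "i \<in> {Min I + 1..<Min I + m}" using i I by auto
  qed
  then show ?thesis
    using that[of "I - {Min I}"] fin ne I by (auto simp: insert_absorb)
qed

text \<open>The set \<open>A\<close> of admissible minima is kept arbitrary: all positions give the
  upper bound for all windows, and the positions just before block boundaries bound the crossing
  windows.\<close>

lemma card_windows_Min_le:
  assumes "k \<ge> 1" "finite A"
  shows "card {I \<in> windows (real m) k n. Min I \<in> A} \<le> card A * ((m - 1) choose (k - 1))"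
proof -
  let ?S = "\<lambda>i. insert i ` {J. J \<subseteq> {i + 1..<i + m} \<and> card J = k - 1}"
  have sub: "{I \<in> windows (real m) k n. Min I \<in> A} \<subseteq> (\<Union>i\<in>A. ?S i)"
  proof
    fix I assume I: "I \<in> {I \<in> windows (real m) k n. Min I \<in> A}"
    then obtain J where "I = insert (Min I) J" "J \<subseteq> {Min I + 1..<Min I + m}" "card J = k - 1"
      using windows_Min_decomp assms(1) by blast
    then show "I \<in> (\<Union>i\<in>A. ?S i)" using I by blast
  qed
  have "card (?S i) \<le> (m - 1) choose (k - 1)" for i
    using card_image_le[of "{J. J \<subseteq> {i + 1..<i + m} \<and> card J = k - 1}" "insert i"]
      n_subsets[of "{i + 1..<i + m}" "k - 1"] by simp
  then have "(\<Sum>i\<in>A. card (?S i)) \<le> card A * ((m - 1) choose (k - 1))"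
    using sum_bounded_above[of A "\<lambda>i. card (?S i)"] by simp
  moreover have "card (\<Union>i\<in>A. ?S i) \<le> (\<Sum>i\<in>A. card (?S i))"
    by (rule card_UN_le[OF assms(2)])
  moreover have "card {I \<in> windows (real m) k n. Min I \<in> A} \<le> card (\<Union>i\<in>A. ?S i)"
    by (rule card_mono[OF _ sub]) (use assms in auto)
  ultimately show ?thesis by linarith
qed

lemma card_windows_le:
  assumes "k \<ge> 1"
  shows "card (windows (real m) k n) \<le> n * ((m - 1) choose (k - 1))"
proof -
  have "Min I \<in> {0..<n}" if "I \<in> windows (real m) k n" for I
  proof -
    have "finite I" "I \<noteq> {}" "I \<subseteq> {0..<n}"
      using that assms finite_subset by (fastforce simp: windows_def)+
    then show ?thesis using Min_in by blast
  qed
  then have "windows (real m) k n = {I \<in> windows (real m) k n. Min I \<in> {0..<n}}" by blast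
  then show ?thesis using card_windows_Min_le[OF assms, of "{0..<n}" m n] by simp
qed

text \<open>For a minimum i with i + m \<le> n all m - 1 following positions exist, so any k - 1 of
  them may be added. Distinct pairs (i, J) give distinct windows because i is recovered as the
  minimum.\<close>

lemma card_windows_ge:
  assumes "k \<ge> 1" "m \<ge> 1" "m \<le> n"
  shows "(n - m + 1) * ((m - 1) choose (k - 1)) \<le> card (windows (real m) k n)"
proof -
  let ?J = "\<lambda>i. {J. J \<subseteq> {i + 1..<i + m} \<and> card J = k - 1}"
  let ?T = "SIGMA i:{0..<n - m + 1}. ?J i"
  have Min: "Min (insert i J) = i" if "J \<in> ?J i" for i J
    using that finite_subset[of J] by (intro Min_eqI) fastforce+
  have inj: "inj_on (\<lambda>(i, J). insert i J) ?T"
  proof (rule inj_onI, clarify)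
    fix i J i' J' assume h: "J \<subseteq> {i + 1..<i + m}" "card J = k - 1" "J' \<subseteq> {i' + 1..<i' + m}" "card J' = k - 1"
      "insert i J = insert i' J'"
    then have "i = i'" using Min[of J i] Min[of J' i'] by auto
    moreover have "i \<notin> J" "i' \<notin> J'" using h by auto
    ultimately show "i = i' \<and> J = J'" using h by (metis insert_ident)
  qed
  have "(\<lambda>(i, J). insert i J) ` ?T \<subseteq> windows (real m) k n"
  proof clarify
    fix i J assume h: "i \<in> {0..<n - m + 1}" "J \<subseteq> {i + 1..<i + m}" "card J = k - 1"
    have fin: "finite J" using h finite_subset by blast
    have "i \<notin> J" using h by auto
    then have "card (insert i J) = k" using fin h assms by simp
    moreover have "insert i {i + 1..<i + m} \<subseteq> {0..<n}" using h(1) assms by auto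
    then have "insert i J \<subseteq> {0..<n}" using h(2) by blast
    moreover have "Max (insert i J) < i + m"
      using fin h assms by (subst Max_less_iff) auto
    ultimately show "insert i J \<in> windows (real m) k n"
      using Min[of J i] h assms by (simp add: windows_of_nat width_def)
  qed
  then have "card ((\<lambda>(i, J). insert i J) ` ?T) \<le> card (windows (real m) k n)"
    by (rule card_mono[rotated]) simp
  moreover have "card ((\<lambda>(i, J). insert i J) ` ?T) = card ?T" by (rule card_image[OF inj])
  moreover have "card ?T = (\<Sum>i\<in>{0..<n - m + 1}. card (?J i))"
    by (rule card_SigmaI) (auto intro: finite_subset[of _ "Pow {_..<_}"])
  moreover have "card (?J i) = (m - 1) choose (k - 1)" for i
    using n_subsets[of "{i + 1..<i + m}" "k - 1"] by simp
  ultimately show ?thesis by simp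
qed

lemma windows_full:
  assumes "k \<ge> 1"
  shows "windows (real n) k n = {I. I \<subseteq> {0..<n} \<and> card I = k}"
proof -
  have "width I \<le> n" if "I \<subseteq> {0..<n}" "card I = k" for I
  proof -
    have "finite I" "I \<noteq> {}" using that assms finite_subset by fastforce+
    then have "Max I \<in> I" by simp
    then have "Max I < n" using that by auto
    then show ?thesis by (simp add: width_def)
  qed
  then show ?thesis by (auto simp: windows_of_nat)
qed

subsection \<open>Blow-ups and lexicographic orders\<close>

text \<open>\<open>blow b \<sigma>\<close> is the infinite direct sum of copies of \<open>\<sigma>\<close> with every point replaced by a
  block of \<open>b\<close> equal values; the ties are broken by the less significant levels.\<close>

definition blow :: "nat \<Rightarrow> nat list \<Rightarrow> nat \<Rightarrow> nat" where
  "blow b \<sigma> i = \<sigma> ! ((i div b) mod length \<sigma>) + length \<sigma> * ((i div b) div length \<sigma>)"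

lemma blow_eq_if_same_block: "i div b = j div b \<Longrightarrow> blow b \<sigma> i = blow b \<sigma> j"
  by (simp add: blow_def)

lemma is_perm_nth_less: "is_perm \<sigma> \<Longrightarrow> a < length \<sigma> \<Longrightarrow> \<sigma> ! a < length \<sigma>"
  unfolding is_perm_def by (metis atLeastLessThan_iff nth_mem)

text \<open>Quotient and remainder of a value by \<open>length \<sigma>\<close> return the copy and
  the entry of \<open>\<sigma>\<close>. The finest level has blocks of length 1, so it separates all
  positions that the coarser levels leave tied.\<close>

lemma inj_blow_1:
  assumes "is_perm \<sigma>" "length \<sigma> > 0"
  shows "inj (blow 1 \<sigma>)"
proof (rule injI)
  fix i j assume h: "blow 1 \<sigma> i = blow 1 \<sigma> j"
  let ?N = "length \<sigma>"
  have lt: "\<sigma> ! (i mod ?N) < ?N" for i using assms by (simp add: is_perm_nth_less)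
  have bl: "blow 1 \<sigma> i = \<sigma> ! (i mod ?N) + ?N * (i div ?N)" for i by (simp add: blow_def)
  have "blow 1 \<sigma> i div ?N = i div ?N" "blow 1 \<sigma> i mod ?N = \<sigma> ! (i mod ?N)" for i
    unfolding bl using lt[of i] assms(2) by simp_all
  then have "i div ?N = j div ?N" "\<sigma> ! (i mod ?N) = \<sigma> ! (j mod ?N)" using h by metis+
  moreover have "i mod ?N = j mod ?N"
    using calculation(2) assms nth_eq_iff_index_eq[of \<sigma> "i mod ?N" "j mod ?N"] by (simp add: is_perm_def)
  ultimately show "i = j" by (metis div_mult_mod_eq)
qed

text \<open>Here \<open>c\<close> numbers the copy of the N-point permutation,
  \<open>\<beta>\<close> the block inside that copy, and \<open>r \<beta>\<close> is the offset
  inside the block of length \<open>b\<close>.\<close>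

definition lift_point :: "nat \<Rightarrow> nat \<Rightarrow> nat \<Rightarrow> (nat \<Rightarrow> nat) \<Rightarrow> nat \<Rightarrow> nat" where
  "lift_point b N c r \<beta> = (c * N + \<beta>) * b + r \<beta>"

text \<open>Offsets are extensional functions on \<open>B\<close>, so that a set \<open>B\<close> of
  size k has exactly b^k of them and different offsets give different lifted sets.\<close>

definition lift_index :: "nat \<Rightarrow> nat \<Rightarrow> nat set set \<Rightarrow> (nat \<times> nat set \<times> (nat \<Rightarrow> nat)) set" where
  "lift_index b q \<B> = (SIGMA c:{..<q}. SIGMA B:\<B>. PiE B (\<lambda>_. {..<b}))"

definition lift_sets :: "nat \<Rightarrow> nat \<Rightarrow> nat \<Rightarrow> nat set set \<Rightarrow> nat set set" where
  "lift_sets b N q \<B> = (\<lambda>(c, B, r). lift_point b N c r ` B) ` lift_index b q \<B>"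

lemma lift_point_div: "r \<beta> < b \<Longrightarrow> lift_point b N c r \<beta> div b = c * N + \<beta>"
  by (simp add: lift_point_def)

lemma lift_point_less_mono:
  assumes "\<beta> < \<beta>'" "r \<beta> < b"
  shows "lift_point b N c r \<beta> < lift_point b N c r \<beta>'"
proof -
  have "lift_point b N c r \<beta> < (c * N + \<beta> + 1) * b"
    using assms by (simp add: lift_point_def)
  also have "\<dots> \<le> (c * N + \<beta>') * b" using assms by (intro mult_right_mono) auto
  finally show ?thesis by (simp add: lift_point_def)
qed

lemma strict_mono_on_lift_point:
  assumes "\<And>\<beta>. \<beta> \<in> B \<Longrightarrow> r \<beta> < b"
  shows "strict_mono_on B (lift_point b N c r)"
  using assms by (intro strict_mono_onI lift_point_less_mono)

lemma blow_lift_point: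
  assumes "\<beta> < length \<sigma>" "r \<beta> < b"
  shows "blow b \<sigma> (lift_point b (length \<sigma>) c r \<beta>) = \<sigma> ! \<beta> + length \<sigma> * c"
proof -
  have "\<sigma> \<noteq> []" using assms(1) by auto
  then have "(c * length \<sigma> + \<beta>) div length \<sigma> = c" "(c * length \<sigma> + \<beta>) mod length \<sigma> = \<beta>"
    using assms(1) by auto
  then show ?thesis using assms by (simp add: blow_def lift_point_div)
qed

text \<open>The indexing of lifted sets is injective: division by \<open>b\<close> returns the
  occupied blocks, dividing the number of one occupied block by \<open>N\<close> returns the copy,
  and what remains in each block is the offset. An occupied block exists because k \<ge> 1.\<close>

lemma card_lift_sets:
  assumes B: "\<And>B. B \<in> \<B> \<Longrightarrow> B \<subseteq> {0..<N} \<and> card B = k" and k: "k \<ge> 1"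
  shows "card (lift_sets b N q \<B>) = q * card \<B> * b ^ k"
proof -
  have finB: "finite B" if "B \<in> \<B>" for B using B[OF that] finite_subset by blast
  have fin: "finite \<B>" by (rule finite_subset[of _ "Pow {0..<N}"]) (use B in auto)
  have "inj_on (\<lambda>(c, B, r). lift_point b N c r ` B) (lift_index b q \<B>)"
  proof (rule inj_onI)
    fix x y
    assume xy: "x \<in> lift_index b q \<B>" "y \<in> lift_index b q \<B>"
      "(case x of (c, B, r) \<Rightarrow> lift_point b N c r ` B) = (case y of (c, B, r) \<Rightarrow> lift_point b N c r ` B)"
    obtain c B r c' B' r' where x: "x = (c, B, r)" and y: "y = (c', B', r')"
      by (cases x, cases y)
    have h: "(c, B, r) \<in> lift_index b q \<B>" "(c', B', r') \<in> lift_index b q \<B>"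
      and eq: "lift_point b N c r ` B = lift_point b N c' r' ` B'"
      using xy by (simp_all add: x y)
    have B1: "B \<in> \<B>" "B' \<in> \<B>" and r: "r \<in> PiE B (\<lambda>_. {..<b})" "r' \<in> PiE B' (\<lambda>_. {..<b})"
      using h by (auto simp: lift_index_def)
    have rb: "\<And>\<beta>. \<beta> \<in> B \<Longrightarrow> r \<beta> < b" "\<And>\<beta>. \<beta> \<in> B' \<Longrightarrow> r' \<beta> < b" using r by auto
    have "(\<lambda>x. x div b) ` lift_point b N c r ` B = (\<lambda>\<beta>. c * N + \<beta>) ` B"
      unfolding image_image by (rule image_cong) (use rb in \<open>auto simp: lift_point_div\<close>)
    moreover have "(\<lambda>x. x div b) ` lift_point b N c' r' ` B' = (\<lambda>\<beta>. c' * N + \<beta>) ` B'"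
      unfolding image_image by (rule image_cong) (use rb in \<open>auto simp: lift_point_div\<close>)
    ultimately have im: "(\<lambda>\<beta>. c * N + \<beta>) ` B = (\<lambda>\<beta>. c' * N + \<beta>) ` B'" using eq by simp
    have "B \<noteq> {}" using B[OF B1(1)] k by auto
    then obtain \<beta> where \<beta>: "\<beta> \<in> B" by blast
    then obtain \<beta>' where \<beta>': "\<beta>' \<in> B'" "c * N + \<beta> = c' * N + \<beta>'" using im by blast
    have lt: "\<beta> < N" "\<beta>' < N" using \<beta> \<beta>' B[OF B1(1)] B[OF B1(2)] by auto
    have "(c * N + \<beta>) div N = c" "(c' * N + \<beta>') div N = c'" using lt by auto
    then have c: "c = c'" using \<beta>'(2) by metis
    then have BB: "B = B'" using im by (simp add: inj_image_eq_iff inj_def)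
    have "r \<beta> = r' \<beta>" if b: "\<beta> \<in> B" for \<beta>
    proof -
      from b have "lift_point b N c r \<beta> \<in> lift_point b N c' r' ` B'" using eq by blast
      then obtain \<gamma> where g: "\<gamma> \<in> B'" "lift_point b N c r \<beta> = lift_point b N c' r' \<gamma>" by blast
      then have "c * N + \<beta> = c' * N + \<gamma>"
        using lift_point_div[of r \<beta> b N c] lift_point_div[of r' \<gamma> b N c'] rb b by auto
      then have "\<beta> = \<gamma>" using c by simp
      then show ?thesis using g c by (simp add: lift_point_def)
    qed
    then have "r = r'" using r BB by (intro PiE_ext[of r B "\<lambda>_. {..<b}" r']) auto
    then show "x = y" using c BB by (simp add: x y)
  qed
  then have "card (lift_sets b N q \<B>) = card (lift_index b q \<B>)"
    unfolding lift_sets_def by (rule card_image)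
  also have "\<dots> = (\<Sum>c\<in>{..<q}. \<Sum>B\<in>\<B>. card (PiE B (\<lambda>_. {..<b})))"
    unfolding lift_index_def using fin finB by (simp add: card_SigmaI finite_PiE)
  also have "\<dots> = (\<Sum>c\<in>{..<q}. \<Sum>B\<in>\<B>. b ^ k)"
    using B finB by (intro sum.cong refl) (simp add: card_PiE)
  finally show ?thesis by simp
qed

text \<open>The blocks met by a window of width \<open>w\<close> lie among \<open>w\<close>
  consecutive ones, which cover \<open>w * b\<close> positions; the \<open>q\<close> copies together
  cover \<open>q * N * b\<close> positions.\<close>

lemma lift_sets_subset_windows:
  assumes "w * b \<le> m" "q * N * b \<le> n" "k \<ge> 1"
  shows "lift_sets b N q (windows (real w) k N) \<subseteq> windows (real m) k n"
  unfolding lift_sets_def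
proof clarify
  fix c B r assume h: "(c, B, r) \<in> lift_index b q (windows (real w) k N)"
  have c: "c < q" and B: "B \<subseteq> {0..<N}" "card B = k" "width B \<le> w" and r: "\<And>\<beta>. \<beta> \<in> B \<Longrightarrow> r \<beta> < b"
    using h by (auto simp: lift_index_def windows_of_nat)
  let ?h = "lift_point b N c r"
  have fin: "finite B" and ne: "B \<noteq> {}" using B assms(3) finite_subset by auto
  have mono: "strict_mono_on B ?h" by (rule strict_mono_on_lift_point[OF r])
  have up: "?h \<beta> < (c * N + \<beta> + 1) * b" if "\<beta> \<in> B" for \<beta> using r[OF that] by (simp add: lift_point_def)
  have lt: "?h \<beta> < n" if "\<beta> \<in> B" for \<beta>
  proof -
    have "c * N + \<beta> + 1 \<le> c * N + N" using that B by auto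
    also have "\<dots> = (c + 1) * N" by simp
    also have "\<dots> \<le> q * N" using c by (intro mult_right_mono) auto
    finally have "(c * N + \<beta> + 1) * b \<le> q * N * b" by (rule mult_right_mono) simp
    then show ?thesis using up[OF that] assms(2) by linarith
  qed
  have "Max (?h ` B) - Min (?h ` B) + 1 \<le> m"
  proof -
    have "Max (?h ` B) \<in> ?h ` B" "Min (?h ` B) \<in> ?h ` B" using fin ne by simp_all
    then obtain x y where xy: "x \<in> B" "y \<in> B" "Max (?h ` B) = ?h x" "Min (?h ` B) = ?h y" by (metis imageE)
    have "x \<le> Max B" "Min B \<le> y" using xy fin by auto
    then have "x + 1 \<le> y + w" using B(3) by (simp add: width_def)
    then have "(c * N + x + 1) * b \<le> (c * N + y + w) * b" by (intro mult_right_mono) auto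
    also have "\<dots> = (c * N + y) * b + w * b" by (simp add: algebra_simps)
    also have "\<dots> \<le> ?h y + m" using assms(1) by (simp add: lift_point_def)
    finally have "?h x < ?h y + m" using up[OF xy(1)] by linarith
    moreover have "?h y \<le> ?h x" using xy fin by (metis Min_le finite_imageI imageI)
    ultimately show ?thesis using xy by simp
  qed
  then show "?h ` B \<in> windows (real m) k n"
    using lt B card_image[OF strict_mono_on_imp_inj_on[OF mono]]
    by (auto simp: windows_of_nat width_def)
qed

text \<open>On a lifted set the blow-up takes the values \<open>\<sigma> ! \<beta>\<close> shifted
  by the constant \<open>length \<sigma> * c\<close>, and lifting is strictly increasing, so neither
  positions nor values change their relative order.\<close>

lemma pat_blow_lift:
  assumes "is_perm \<sigma>" "(c, B, r) \<in> lift_index b q \<B>" "B \<subseteq> {0..<length \<sigma>}"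
  shows "pat (blow b \<sigma>) (lift_point b (length \<sigma>) c r ` B) = pat_at \<sigma> B"
    and "inj_on (blow b \<sigma>) (lift_point b (length \<sigma>) c r ` B)"
proof -
  let ?h = "lift_point b (length \<sigma>) c r"
  have r: "\<And>\<beta>. \<beta> \<in> B \<Longrightarrow> r \<beta> < b" using assms by (auto simp: lift_index_def)
  have fin: "finite B" using assms finite_subset by blast
  have mono: "strict_mono_on B ?h" by (rule strict_mono_on_lift_point[OF r])
  have bl: "blow b \<sigma> (?h \<beta>) = \<sigma> ! \<beta> + length \<sigma> * c" if "\<beta> \<in> B" for \<beta>
    using that assms r by (intro blow_lift_point) auto
  have inj: "inj_on ((!) \<sigma>) B"
    using assms by (intro inj_on_nth) (auto simp: is_perm_def)
  then have inj2: "inj_on (blow b \<sigma> \<circ> ?h) B"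
    using bl by (auto simp: inj_on_def)
  show "pat (blow b \<sigma>) (?h ` B) = pat_at \<sigma> B"
    unfolding pat_image[OF fin mono] pat_at_eq_pat
    by (rule pat_cong_order[OF fin inj2 inj]) (use bl in auto)
  show "inj_on (blow b \<sigma>) (?h ` B)" using inj2 by (rule inj_on_imageI)
qed

text \<open>The sets in \<^term>\<open>lift_sets b N q (windows (real w) k N)\<close> have at most one point
  in each block and lie inside a single copy of \<open>\<sigma>\<close>. Every window of \<open>\<sigma>\<close> gives rise to the
  same number of them, so that among them the frequency of \<open>\<pi>\<close> is exactly \<open>rho w \<pi> \<sigma>\<close>.\<close>

lemma rho_blow_approx:
  fixes \<pi> \<sigma> \<tau> :: "nat list" and m :: nat
  defines "k \<equiv> length \<pi>" and "N \<equiv> length \<sigma>" and "n \<equiv> length \<tau>"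
  defines "W \<equiv> windows (real m) k n"
  assumes perm: "is_perm \<sigma>" and k: "k \<ge> 1"
    and fit: "w * b \<le> m" "q * N * b \<le> n"
    and agree: "\<And>I. I \<in> W \<Longrightarrow> I \<notin> X \<Longrightarrow> inj_on (blow b \<sigma>) I \<Longrightarrow> pat_at \<tau> I = pat (blow b \<sigma>) I"
    and most: "real (q * card (windows (real w) k N) * b ^ k) \<ge> (1 - \<epsilon>) * real (card W)"
    and few: "real (card (W \<inter> X)) \<le> \<epsilon> * real (card W)"
    and W: "card W > 0"
  shows "\<bar>rho (real m) \<pi> \<tau> - rho (real w) \<pi> \<sigma>\<bar> \<le> 2 * \<epsilon>"
proof -
  let ?V = "windows (real w) k N"
  let ?V\<pi> = "{B \<in> ?V. pat_at \<sigma> B = \<pi>}"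
  let ?D = "lift_sets b N q ?V" and ?D\<pi> = "lift_sets b N q ?V\<pi>"
  let ?W\<pi> = "{I \<in> W. pat_at \<tau> I = \<pi>}"
  have finW: "finite W" by (simp add: W_def)
  have DW: "?D \<subseteq> W" unfolding W_def by (rule lift_sets_subset_windows[OF fit k])
  have D\<pi>D: "?D\<pi> \<subseteq> ?D" by (auto simp: lift_sets_def lift_index_def)
  have finD: "finite ?D" using finW DW finite_subset by blast
  have cD: "card ?D = q * card ?V * b ^ k" and cD\<pi>: "card ?D\<pi> = q * card ?V\<pi> * b ^ k"
    using k by (auto intro!: card_lift_sets simp: windows_of_nat)
  have patD: "pat (blow b \<sigma>) I = \<pi> \<longleftrightarrow> I \<in> ?D\<pi>" "inj_on (blow b \<sigma>) I" if I: "I \<in> ?D" for I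
  proof -
    obtain c B r where h: "(c, B, r) \<in> lift_index b q ?V" "I = lift_point b N c r ` B"
      using I by (auto simp: lift_sets_def)
    have B: "B \<subseteq> {0..<length \<sigma>}" using h by (auto simp: lift_index_def windows_of_nat N_def)
    show "inj_on (blow b \<sigma>) I" using pat_blow_lift(2)[OF perm h(1) B] h(2) by (simp add: N_def)
    show "pat (blow b \<sigma>) I = \<pi> \<longleftrightarrow> I \<in> ?D\<pi>"
    proof
      assume "pat (blow b \<sigma>) I = \<pi>"
      then have "pat_at \<sigma> B = \<pi>" using pat_blow_lift(1)[OF perm h(1) B] h(2) by (simp add: N_def)
      then have "(c, B, r) \<in> lift_index b q ?V\<pi>" using h(1) by (auto simp: lift_index_def)
      then show "I \<in> ?D\<pi>" unfolding lift_sets_def h(2) by force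
    next
      assume "I \<in> ?D\<pi>"
      then obtain c' B' r' where h': "(c', B', r') \<in> lift_index b q ?V\<pi>" "I = lift_point b N c' r' ` B'"
        by (auto simp: lift_sets_def)
      have "B' \<subseteq> {0..<length \<sigma>}" "pat_at \<sigma> B' = \<pi>"
        using h' by (auto simp: lift_index_def windows_of_nat N_def)
      then show "pat (blow b \<sigma>) I = \<pi>"
        using pat_blow_lift(1)[OF perm h'(1)] h'(2) by (simp add: N_def)
    qed
  qed
  \<comment> \<open>An occurrence of \<pi> in \<open>\<tau>\<close> is a lifted occurrence unless
    its window is not lifted at all or belongs to \<open>X\<close>; conversely a lifted occurrence
    can be lost only in \<open>X\<close>.\<close>
  have "?W\<pi> \<subseteq> ?D\<pi> \<union> (W - ?D) \<union> (W \<inter> X)"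
  proof
    fix I assume "I \<in> ?W\<pi>"
    then show "I \<in> ?D\<pi> \<union> (W - ?D) \<union> (W \<inter> X)"
      using agree[of I] patD[of I] by (cases "I \<in> ?D"; cases "I \<in> X") auto
  qed
  then have "card ?W\<pi> \<le> card (?D\<pi> \<union> (W - ?D) \<union> (W \<inter> X))"
    using finW finD D\<pi>D by (intro card_mono) (auto intro: finite_subset)
  also have "\<dots> \<le> card ?D\<pi> + card (W - ?D) + card (W \<inter> X)"
    by (meson add_mono_thms_linordered_semiring(3) card_Un_le order_trans)
  finally have up: "card ?W\<pi> \<le> card ?D\<pi> + (card W - card ?D) + card (W \<inter> X)"
    by (simp add: card_Diff_subset[OF finD DW])
  have "?D\<pi> \<subseteq> ?W\<pi> \<union> (W \<inter> X)"
  proof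
    fix I assume "I \<in> ?D\<pi>"
    then show "I \<in> ?W\<pi> \<union> (W \<inter> X)"
      using agree[of I] patD[of I] D\<pi>D DW by (cases "I \<in> X") auto
  qed
  then have "card ?D\<pi> \<le> card (?W\<pi> \<union> (W \<inter> X))" using finW by (intro card_mono) auto
  also have "\<dots> \<le> card ?W\<pi> + card (W \<inter> X)" by (rule card_Un_le)
  finally have lo: "card ?D\<pi> \<le> card ?W\<pi> + card (W \<inter> X)" .
  define R where "R = rho (real w) \<pi> \<sigma>"
  have R: "0 \<le> R" "R \<le> 1" "R * real (card ?D) = real (card ?D\<pi>)"
  proof -
    have R_eq: "R = real (card ?V\<pi>) / real (card ?V)" by (simp add: R_def rho_def k_def N_def)
    have "card ?V\<pi> \<le> card ?V" by (intro card_mono) auto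
    then show "0 \<le> R" "R \<le> 1" by (auto simp: R_eq divide_le_eq_1)
    show "R * real (card ?D) = real (card ?D\<pi>)"
    proof (cases "card ?V = 0")
      case True
      then have "card ?V\<pi> = 0" using \<open>card ?V\<pi> \<le> card ?V\<close> by simp
      then show ?thesis using True cD cD\<pi> by simp
    qed (simp add: R_eq cD cD\<pi>)
  qed
  have DleW: "card ?D \<le> card W" by (rule card_mono[OF finW DW])
  \<comment> \<open>\<open>x\<close> counts the windows that are not lifted. The product of
    \<open>R\<close> and |W| exceeds the number of lifted occurrences by R x, where 0 \<le> R x
    \<le> x. So unlifted windows cost at most \<epsilon> |W| in either direction, and
    \<open>X\<close> costs another \<epsilon> |W|.\<close>
  define x where "x = real (card W) - real (card ?D)"
  have x: "0 \<le> x" "x \<le> \<epsilon> * real (card W)"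
    using of_nat_mono[OF DleW, where ?'a = real] most by (simp_all add: x_def flip: cD) (simp add: algebra_simps)
  have Rx: "0 \<le> R * x" "R * x \<le> x"
    using R x by (auto intro: mult_left_le_one_le)
  have RW: "R * real (card W) = real (card ?D\<pi>) + R * x"
    using R(3) by (simp add: x_def algebra_simps)
  have up': "real (card ?W\<pi>) \<le> real (card ?D\<pi>) + x + real (card (W \<inter> X))"
    using of_nat_mono[OF up, where ?'a = real] DleW by (simp add: x_def of_nat_diff)
  have lo': "real (card ?D\<pi>) \<le> real (card ?W\<pi>) + real (card (W \<inter> X))"
    using of_nat_mono[OF lo, where ?'a = real] by simp
  have "\<bar>real (card ?W\<pi>) - R * real (card W)\<bar> \<le> 2 * \<epsilon> * real (card W)"
    using up' lo' RW Rx x few by linarith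
  then have "\<bar>real (card ?W\<pi>) - R * real (card W)\<bar> / real (card W) \<le> 2 * \<epsilon>"
    using W by (simp add: divide_le_eq)
  moreover have "rho (real m) \<pi> \<tau> - R = (real (card ?W\<pi>) - R * real (card W)) / real (card W)"
    using W finW by (simp add: rho_def W_def k_def n_def diff_divide_distrib card_gt_0_iff)
  ultimately show ?thesis by (simp add: R_def abs_divide)
qed

section \<open>Lexicographic comparison of finitely many levels\<close>

lemma lexicographic_key_exists:
  fixes g :: "nat \<Rightarrow> nat \<Rightarrow> nat"
  shows "\<exists>V :: nat \<Rightarrow> nat. \<forall>i<n. \<forall>j<n. \<forall>l\<le>L.
    (\<forall>s. l < s \<and> s \<le> L \<longrightarrow> g s i = g s j) \<and> g l i < g l j \<longrightarrow> V i < V j"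
proof (induction L)
  case 0
  show ?case by (rule exI[of _ "g 0"]) auto
next
  case (Suc L)
  then obtain V :: "nat \<Rightarrow> nat" where V: "\<forall>i<n. \<forall>j<n. \<forall>l\<le>L.
    (\<forall>s. l < s \<and> s \<le> L \<longrightarrow> g s i = g s j) \<and> g l i < g l j \<longrightarrow> V i < V j" by blast
  \<comment> \<open>Mixed radix: \<open>M\<close> exceeds every lower key on the positions below
    \<open>n\<close>, so a difference at the new level outweighs all lower levels, while a tie
    leaves the old order intact.\<close>
  define M where "M = Suc (Max (V ` {..<n}))"
  have M: "V i < M" if "i < n" for i
    using that by (simp add: M_def le_imp_less_Suc)
  show ?case
  proof (rule exI[of _ "\<lambda>i. g (Suc L) i * M + V i"], intro allI impI)
    fix i j l assume h: "i < n" "j < n" "l \<le> Suc L"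
      "(\<forall>s. l < s \<and> s \<le> Suc L \<longrightarrow> g s i = g s j) \<and> g l i < g l j"
    show "g (Suc L) i * M + V i < g (Suc L) j * M + V j"
    proof (cases "l = Suc L")
      case True
      then have "(g (Suc L) i + 1) * M \<le> g (Suc L) j * M" using h by (intro mult_right_mono) auto
      then show ?thesis using M[OF h(1)] by simp
    next
      case False
      then have "l \<le> L" using h by simp
      then have "V i < V j" using V[rule_format, of i j l] h by simp
      moreover have "g (Suc L) i = g (Suc L) j" using h False by auto
      ultimately show ?thesis by simp
    qed
  qed
qed

text \<open>The largest index is the most significant level. Injectivity of level 0 makes the keys
  distinct, so their ranks form a permutation. Where all levels above \<open>l\<close> are tied and
  level \<open>l\<close> is injective, level \<open>l\<close> alone decides.\<close>

lemma lexicographic_perm_exists: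
  fixes g :: "nat \<Rightarrow> nat \<Rightarrow> nat"
  assumes "inj (g 0)"
  obtains \<tau> where "is_perm \<tau>" "length \<tau> = n"
    "\<And>I l. I \<subseteq> {0..<n} \<Longrightarrow> l \<le> L \<Longrightarrow> inj_on (g l) I \<Longrightarrow>
       (\<And>s i j. l < s \<Longrightarrow> s \<le> L \<Longrightarrow> i \<in> I \<Longrightarrow> j \<in> I \<Longrightarrow> g s i = g s j) \<Longrightarrow>
       pat_at \<tau> I = pat (g l) I"
proof -
  obtain V :: "nat \<Rightarrow> nat" where key: "\<forall>i<n. \<forall>j<n. \<forall>l\<le>L.
    (\<forall>s. l < s \<and> s \<le> L \<longrightarrow> g s i = g s j) \<and> g l i < g l j \<longrightarrow> V i < V j"
    using lexicographic_key_exists[of n L g] by (elim exE)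
  have V: "V i < V j"
    if "i < n" "j < n" "l \<le> L" "\<And>s. l < s \<Longrightarrow> s \<le> L \<Longrightarrow> g s i = g s j" "g l i < g l j" for i j l
    by (rule key[rule_format, of i j l]) (use that in auto)
  have injV: "inj_on V {0..<n}"
  proof (rule inj_onI, rule ccontr)
    fix i j assume h: "i \<in> {0..<n}" "j \<in> {0..<n}" "V i = V j" "i \<noteq> j"
    let ?P = "\<lambda>l. l \<le> L \<and> g l i \<noteq> g l j"
    have P0: "?P 0" using assms h(4) by (auto dest: injD)
    \<comment> \<open>The highest level at which \<open>i\<close> and \<open>j\<close> differ exists
      because level 0 separates them; it would force different keys.\<close>
    define l where "l = (GREATEST l. ?P l)"
    have Pl: "?P l" unfolding l_def by (rule GreatestI_nat[of ?P 0 L]) (use P0 in auto)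
    have tie: "g s i = g s j" if "l < s" "s \<le> L" for s
      using Greatest_le_nat[of ?P s L] that by (auto simp: l_def)
    show False
    proof (cases "g l i" "g l j" rule: linorder_cases)
      case less
      then show False using V[of i j l] Pl tie h by simp
    next
      case greater
      then show False using V[of j i l] Pl tie[symmetric] h by simp
    qed (use Pl in auto)
  qed
  define \<tau> where "\<tau> = std (map V [0..<n])"
  have dist: "distinct (map V [0..<n])" using injV by (simp add: distinct_map)
  have \<tau>_less_iff: "\<tau> ! i < \<tau> ! j \<longleftrightarrow> V i < V j" if "i < n" "j < n" for i j
    using std_nth_less_iff[OF dist, of i j] that by (simp add: \<tau>_def)
  have perm: "is_perm \<tau>" and len: "length \<tau> = n" using is_perm_std[OF dist] by (simp_all add: \<tau>_def)
  moreover have "pat_at \<tau> I = pat (g l) I"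
    if I: "I \<subseteq> {0..<n}" "l \<le> L" "inj_on (g l) I"
      "\<And>s i j. l < s \<Longrightarrow> s \<le> L \<Longrightarrow> i \<in> I \<Longrightarrow> j \<in> I \<Longrightarrow> g s i = g s j" for I l
    unfolding pat_at_eq_pat
  proof (rule pat_cong_order)
    show "finite I" using I finite_subset by blast
    show "inj_on ((!) \<tau>) I" using perm len I by (intro inj_on_nth) (auto simp: is_perm_def)
    fix i j assume ij: "i \<in> I" "j \<in> I"
    then have n: "i < n" "j < n" using I by auto
    show "\<tau> ! i < \<tau> ! j \<longleftrightarrow> g l i < g l j"
    proof (cases "g l i" "g l j" rule: linorder_cases)
      case less
      then have "V i < V j" using V[OF n I(2)] I(4) ij by blast
      then show ?thesis using less \<tau>_less_iff n by auto
    next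
      case equal
      then have "i = j" using I(3) ij by (auto dest: inj_onD)
      then show ?thesis by simp
    next
      case greater
      then have "V j < V i" using V[OF n(2,1) I(2)] I(4) ij by blast
      then show ?thesis using greater \<tau>_less_iff n by auto
    qed
  qed (use I in auto)
  ultimately show ?thesis using that by blast
qed

section \<open>Windows that cross a block boundary\<close>

definition crossing :: "nat \<Rightarrow> nat set set" where
  "crossing b = {I. Min I div b \<noteq> Max I div b}"

lemma same_block_if_not_crossing:
  assumes "I \<notin> crossing b" "finite I" "i \<in> I" "j \<in> I"
  shows "i div b = j div b"
proof -
  have "x div b = Min I div b" if "x \<in> I" for x
  proof -
    have "Min I \<le> x" "x \<le> Max I" using that assms by auto
    then have "Min I div b \<le> x div b" "x div b \<le> Max I div b" by (auto intro: div_le_mono)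
    then show ?thesis using assms(1) by (auto simp: crossing_def)
  qed
  then show ?thesis using assms by metis
qed

text \<open>A crossing window has its minimum among the last m - 1 positions of a block, which
  leaves fewer than m choices in each of at most n div b + 1 blocks. The factor 4 is 2 times 2: b
  \<le> n gives n / b + 1 \<le> 2 n / b, and 2 m \<le> n leaves at least n / 2 minima in the lower
  bound for all windows.\<close>

lemma card_windows_crossing_le:
  assumes k: "k \<ge> 1" and m: "m \<ge> 1" "2 * m \<le> n" and b: "0 < b" "b \<le> n"
    and \<delta>: "4 * real m \<le> \<delta> * real b"
  shows "real (card (windows (real m) k n \<inter> crossing b)) \<le> \<delta> * real (card (windows (real m) k n))"
proof -
  let ?A = "{i. i < n \<and> b < i mod b + m}"
  let ?C = "(m - 1) choose (k - 1)"
  have "windows (real m) k n \<inter> crossing b \<subseteq> {I \<in> windows (real m) k n. Min I \<in> ?A}"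
  proof
    fix I assume I: "I \<in> windows (real m) k n \<inter> crossing b"
    then have h: "I \<subseteq> {0..<n}" "card I = k" "Max I - Min I + 1 \<le> m" "Min I div b \<noteq> Max I div b"
      by (auto simp: windows_of_nat width_def crossing_def)
    have fin: "finite I" and ne: "I \<noteq> {}" using h k finite_subset by auto
    then have mM: "Min I \<le> Max I" "Min I < n" using h(1) Min_in[OF fin ne] by (auto simp: subset_iff)
    have "Min I div b < Max I div b" using h(4) mM(1) by (simp add: div_le_mono le_neq_implies_less)
    then have "(Min I div b + 1) * b \<le> Max I div b * b" by (intro mult_right_mono) auto
    also have "\<dots> \<le> Max I" by simp
    also have "\<dots> < Min I + m" using h(3) mM by linarith
    finally have "Min I div b * b + b < Min I + m" by (simp add: add_mult_distrib)
    then have "b < Min I mod b + m" using div_mult_mod_eq[of "Min I" b] by linarith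
    then show "I \<in> {I \<in> windows (real m) k n. Min I \<in> ?A}" using I mM by simp
  qed
  then have "card (windows (real m) k n \<inter> crossing b) \<le> card {I \<in> windows (real m) k n. Min I \<in> ?A}"
    by (intro card_mono) auto
  also have "\<dots> \<le> card ?A * ?C" by (rule card_windows_Min_le[OF k]) simp
  finally have 1: "card (windows (real m) k n \<inter> crossing b) \<le> card ?A * ?C" .
  have "card ?A \<le> card ({0..n div b} \<times> {0..<m})"
  proof (rule card_inj_on_le[of "\<lambda>i. (i div b, b - 1 - i mod b)"])
    show "inj_on (\<lambda>i. (i div b, b - 1 - i mod b)) ?A"
    proof (rule inj_onI)
      fix i j assume "(i div b, b - 1 - i mod b) = (j div b, b - 1 - j mod b)"
      moreover have "i mod b < b" "j mod b < b" using b by auto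
      ultimately have "i div b = j div b" "i mod b = j mod b" by (simp, simp, linarith)
      then show "i = j" by (metis div_mult_mod_eq)
    qed
    show "(\<lambda>i. (i div b, b - 1 - i mod b)) ` ?A \<subseteq> {0..n div b} \<times> {0..<m}"
      using m by (auto intro!: div_le_mono)
  qed simp
  then have 2: "card ?A \<le> (n div b + 1) * m" by simp
  have 3: "(n - m + 1) * ?C \<le> card (windows (real m) k n)"
    using m by (intro card_windows_ge[OF k]) auto
  have "0 \<le> \<delta> * real b" using \<delta> by linarith
  then have \<delta>0: "\<delta> \<ge> 0" using b by (simp add: zero_le_mult_iff)
  have "real (n div b) + 1 \<le> real n / real b + 1" using of_nat_div_le_of_nat[of n b, where ?'a = real] by simp
  also have "\<dots> \<le> 2 * real n / real b" using b by (simp add: field_simps)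
  finally have "(real (n div b) + 1) * real m \<le> 2 * real n / real b * real m"
    by (rule mult_right_mono) simp
  then have "real ((n div b + 1) * m) \<le> 2 * real n / real b * real m"
    by (simp add: algebra_simps)
  also have "\<dots> = real n * (4 * real m) / (2 * real b)" using b by (simp add: field_simps)
  also have "\<dots> \<le> real n * (\<delta> * real b) / (2 * real b)"
    using \<delta> by (intro divide_right_mono mult_left_mono) auto
  also have "\<dots> = \<delta> * (real n / 2)" using b by simp
  also have "\<dots> \<le> \<delta> * real (n - m + 1)"
    using m \<delta>0 by (intro mult_left_mono) (auto simp: of_nat_diff)
  finally have 4: "real ((n div b + 1) * m) \<le> \<delta> * real (n - m + 1)" .
  have "real (card (windows (real m) k n \<inter> crossing b)) \<le> real ((n div b + 1) * m * ?C)"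
    using 1 2 by (meson mult_le_mono1 of_nat_le_iff order_trans)
  also have "\<dots> = real ((n div b + 1) * m) * real ?C" by simp
  also have "\<dots> \<le> \<delta> * real (n - m + 1) * real ?C" by (rule mult_right_mono[OF 4]) simp
  also have "\<dots> = \<delta> * real ((n - m + 1) * ?C)" by (simp only: of_nat_mult mult.assoc)
  also have "\<dots> \<le> \<delta> * real (card (windows (real m) k n))"
    using 3 \<delta>0 by (intro mult_left_mono) (simp_all only: of_nat_le_iff)
  finally show ?thesis .
qed

subsection \<open>Sampling from a permuton\<close>

text \<open>Ranks of the two coordinates of sampled points become positions and values of a
  permutation; ranks of the values of scaling functions at one n sort the scales.\<close>

lemma ex_rank_function:
  fixes x :: "nat \<Rightarrow> 'a::linorder"
  assumes "inj_on x {0..<N}"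
  obtains r where "bij_betw r {0..<N} {0..<N}"
    "\<And>a b. a < N \<Longrightarrow> b < N \<Longrightarrow> r a < r b \<longleftrightarrow> x a < x b"
proof -
  define r where "r a = card {c. c < N \<and> x c < x a}" for a
  have mono: "r a < r b" if "a < N" "b < N" "x a < x b" for a b
    unfolding r_def by (rule psubset_card_mono) (use that in auto)
  have inj: "inj_on r {0..<N}"
  proof (rule inj_onI)
    fix a b assume h: "a \<in> {0..<N}" "b \<in> {0..<N}" "r a = r b"
    then have "x a = x b" using mono[of a b] mono[of b a] by (metis atLeastLessThan_iff less_irrefl linorder_cases)
    then show "a = b" using assms h by (auto dest: inj_onD)
  qed
  have "r a < N" if "a < N" for a
  proof -
    have "r a \<le> card ({0..<N} - {a})" unfolding r_def by (rule card_mono) auto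
    then show ?thesis using that by simp
  qed
  then have "r ` {0..<N} \<subseteq> {0..<N}" by auto
  then have "bij_betw r {0..<N} {0..<N}"
    unfolding bij_betw_def using inj endo_inj_surj by blast
  moreover have "r a < r b \<longleftrightarrow> x a < x b" if "a < N" "b < N" for a b
    using that mono[of a b] mono[of b a]
    by (cases "x a" "x b" rule: linorder_cases) (use assms in \<open>auto dest: inj_onD\<close>)
  ultimately show ?thesis using that by blast
qed

text \<open>The condition of \<open>pattern_event\<close> for the points with indices in
  \<open>S\<close>. The x-coordinates along \<open>s\<close> increase strictly, so \<open>s\<close>
  is injective on the indices below \<open>length \<pi>\<close>; when \<open>S\<close> has
  \<open>length \<pi>\<close> elements, it is the enumeration of \<open>S\<close> by
  x-coordinate.\<close>

definition forms :: "nat list \<Rightarrow> nat set \<Rightarrow> (nat \<Rightarrow> real \<times> real) \<Rightarrow> bool" where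
  "forms \<pi> S p \<longleftrightarrow> (\<exists>s. (\<forall>a<length \<pi>. s a \<in> S) \<and>
      (\<forall>a<length \<pi>. \<forall>b<length \<pi>.
         (a < b \<longrightarrow> fst (p (s a)) < fst (p (s b))) \<and>
         (snd (p (s a)) < snd (p (s b)) \<longleftrightarrow> \<pi> ! a < \<pi> ! b)))"

lemma pattern_event_eq_forms: "pattern_event \<pi> = {p. forms \<pi> {0..<length \<pi>} p}"
  by (simp add: pattern_event_def forms_def)

lemma forms_cong: "(\<And>a. a \<in> S \<Longrightarrow> p a = p' a) \<Longrightarrow> forms \<pi> S p \<longleftrightarrow> forms \<pi> S p'"
  unfolding forms_def by (intro ex_cong1) auto

lemma forms_image: "forms \<pi> (e ` S) p \<longleftrightarrow> forms \<pi> S (p \<circ> e)"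
proof
  assume "forms \<pi> S (p \<circ> e)"
  then obtain s where "\<forall>a<length \<pi>. s a \<in> S"
      "\<forall>a<length \<pi>. \<forall>b<length \<pi>.
         (a < b \<longrightarrow> fst (p (e (s a))) < fst (p (e (s b)))) \<and>
         (snd (p (e (s a))) < snd (p (e (s b))) \<longleftrightarrow> \<pi> ! a < \<pi> ! b)"
    unfolding forms_def o_def by blast
  then show "forms \<pi> (e ` S) p" unfolding forms_def by (intro exI[of _ "e \<circ> s"]) simp
next
  assume "forms \<pi> (e ` S) p"
  then obtain s where s: "\<forall>a<length \<pi>. s a \<in> e ` S"
      "\<forall>a<length \<pi>. \<forall>b<length \<pi>.
         (a < b \<longrightarrow> fst (p (s a)) < fst (p (s b))) \<and>
         (snd (p (s a)) < snd (p (s b)) \<longleftrightarrow> \<pi> ! a < \<pi> ! b)"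
    unfolding forms_def by blast
  then have "\<forall>a. \<exists>t. a < length \<pi> \<longrightarrow> t \<in> S \<and> s a = e t" by blast
  then obtain t where "\<forall>a<length \<pi>. t a \<in> S \<and> s a = e (t a)" by metis
  then show "forms \<pi> S (p \<circ> e)" unfolding forms_def using s(2) by (intro exI[of _ t]) simp
qed

text \<open>The rank in x is the position and the rank in y is the value, so \<open>\<sigma>\<close>
  is \<open>ry\<close> after the inverse of \<open>rx\<close>. Then \<open>rx\<close> maps the index
  sets that form \<pi> bijectively to the occurrences of \<pi>, and the global density becomes a
  plain average over k-subsets.\<close>

lemma perm_of_points:
  fixes p :: "nat \<Rightarrow> real \<times> real"
  assumes x: "inj_on (\<lambda>a. fst (p a)) {0..<N}" and y: "inj_on (\<lambda>a. snd (p a)) {0..<N}"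
  obtains \<sigma> where "is_perm \<sigma>" "length \<sigma> = N"
    "\<And>\<pi>. \<pi> \<in> PermS \<Longrightarrow> global_density \<pi> \<sigma> =
       real (card {S. S \<subseteq> {0..<N} \<and> card S = length \<pi> \<and> forms \<pi> S p}) / real (N choose length \<pi>)"
proof -
  obtain rx where rx: "bij_betw rx {0..<N} {0..<N}"
    "\<And>a b. a < N \<Longrightarrow> b < N \<Longrightarrow> rx a < rx b \<longleftrightarrow> fst (p a) < fst (p b)"
    using ex_rank_function[OF x] by blast
  obtain ry where ry: "bij_betw ry {0..<N} {0..<N}"
    "\<And>a b. a < N \<Longrightarrow> b < N \<Longrightarrow> ry a < ry b \<longleftrightarrow> snd (p a) < snd (p b)"
    using ex_rank_function[OF y] by blast
  define ix where "ix = inv_into {0..<N} rx"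
  have ix: "bij_betw ix {0..<N} {0..<N}" unfolding ix_def by (rule bij_betw_inv_into[OF rx(1)])
  have ixrx: "ix (rx a) = a" if "a < N" for a
    unfolding ix_def using rx(1) that by (intro inv_into_f_f) (auto simp: bij_betw_def)
  have rxix: "rx (ix i) = i" "ix i < N" if "i < N" for i
    using that rx(1) bij_betwE[OF ix] unfolding ix_def
    by (auto intro!: f_inv_into_f simp: bij_betw_def)
  have rxN: "rx a < N" if "a < N" for a using that bij_betwE[OF rx(1)] by auto
  define \<sigma> where "\<sigma> = map (ry \<circ> ix) [0..<N]"
  have len: "length \<sigma> = N" by (simp add: \<sigma>_def)
  have nth: "\<sigma> ! i = ry (ix i)" if "i < N" for i using that by (simp add: \<sigma>_def)
  have "bij_betw (ry \<circ> ix) {0..<N} {0..<N}" by (rule bij_betw_trans[OF ix ry(1)])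
  then have perm: "is_perm \<sigma>"
    unfolding is_perm_def len by (simp add: \<sigma>_def distinct_map bij_betw_def)
  have pat: "pat_at \<sigma> (rx ` S) = \<pi> \<longleftrightarrow> forms \<pi> S p"
    if S: "S \<subseteq> {0..<N}" "card S = length \<pi>" and \<pi>: "is_perm \<pi>" for S \<pi>
  proof -
    let ?k = "length \<pi>"
    define xs where "xs = sorted_list_of_set (rx ` S)"
    have fin: "finite S" using S finite_subset by blast
    have injS: "inj_on rx S" using S rx(1) by (auto simp: bij_betw_def inj_on_subset)
    have set_xs: "set xs = rx ` S" and len_xs: "length xs = ?k" and dist: "distinct xs" and sorted: "sorted xs"
      using fin card_image[OF injS] S by (simp_all add: xs_def)
    have xsN: "xs ! a < N" if "a < ?k" for a
      using nth_mem[of a xs] that len_xs set_xs S rxN by auto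
    have dmap: "distinct (map ((!) \<sigma>) xs)"
      unfolding distinct_map using dist set_xs S rxN len perm
      by (auto intro!: inj_on_nth simp: is_perm_def)
    have "pat_at \<sigma> (rx ` S) = \<pi> \<longleftrightarrow>
        (\<forall>a<?k. \<forall>b<?k. \<sigma> ! (xs ! a) < \<sigma> ! (xs ! b) \<longleftrightarrow> \<pi> ! a < \<pi> ! b)"
      unfolding pat_at_def xs_def[symmetric]
      by (subst std_eq_iff[OF dmap \<pi>]) (simp_all add: len_xs)
    also have "\<dots> \<longleftrightarrow> (\<forall>a<?k. \<forall>b<?k. snd (p (ix (xs ! a))) < snd (p (ix (xs ! b))) \<longleftrightarrow> \<pi> ! a < \<pi> ! b)"
      using xsN by (simp add: nth ry(2) rxix)
    also have "\<dots> \<longleftrightarrow> forms \<pi> S p"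
    proof
      assume h: "\<forall>a<?k. \<forall>b<?k. snd (p (ix (xs ! a))) < snd (p (ix (xs ! b))) \<longleftrightarrow> \<pi> ! a < \<pi> ! b"
      have "ix (xs ! a) \<in> S" if "a < ?k" for a
        using nth_mem[of a xs] that len_xs set_xs S ixrx by auto
      moreover have "fst (p (ix (xs ! a))) < fst (p (ix (xs ! b)))" if "a < b" "b < ?k" for a b
      proof -
        have "sorted_wrt (<) xs" using sorted dist by (simp add: strict_sorted_iff)
        then have "xs ! a < xs ! b" using that len_xs by (simp add: sorted_wrt_nth_less)
        then show ?thesis using rx(2)[of "ix (xs ! a)" "ix (xs ! b)"] rxix xsN that by simp
      qed
      ultimately show "forms \<pi> S p" unfolding forms_def
        using h by (intro exI[of _ "\<lambda>a. ix (xs ! a)"]) auto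
    next
      assume "forms \<pi> S p"
      then obtain s where s0: "\<forall>a<?k. s a \<in> S"
        "\<forall>a<?k. \<forall>b<?k. (a < b \<longrightarrow> fst (p (s a)) < fst (p (s b))) \<and>
           (snd (p (s a)) < snd (p (s b)) \<longleftrightarrow> \<pi> ! a < \<pi> ! b)"
        unfolding forms_def by blast
      then have s: "\<And>a. a < ?k \<Longrightarrow> s a \<in> S"
        "\<And>a b. a < b \<Longrightarrow> b < ?k \<Longrightarrow> fst (p (s a)) < fst (p (s b))"
        "\<And>a b. a < ?k \<Longrightarrow> b < ?k \<Longrightarrow> snd (p (s a)) < snd (p (s b)) \<longleftrightarrow> \<pi> ! a < \<pi> ! b"
        by simp_all
      have sN: "s a < N" if "a < ?k" for a using s(1)[OF that] S by auto
      \<comment> \<open>Any witness \<open>s\<close> enumerates \<open>S\<close> by x-rank: its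
        ranks form a strictly increasing list with the same elements as \<open>xs\<close>, hence the
        list \<open>xs\<close>.\<close>
      define ys where "ys = map (rx \<circ> s) [0..<?k]"
      have ys: "ys ! a < ys ! b" if "a < b" "b < ?k" for a b
        using that s(2)[OF that] sN rx(2) by (simp add: ys_def)
      have "sorted_wrt (<) ys" unfolding sorted_wrt_iff_nth_less using ys by (simp add: ys_def)
      then have dy: "distinct ys" and sy: "sorted ys"
        by (simp_all add: strict_sorted_iff)
      have "set ys \<subseteq> rx ` S" using s(1) by (auto simp: ys_def)
      moreover have "card (set ys) = card (rx ` S)"
        using distinct_card[OF dy] card_image[OF injS] S by (simp add: ys_def)
      ultimately have "set ys = rx ` S" using fin by (intro card_subset_eq) auto
      then have "ys = xs"
        using sorted_distinct_set_unique[OF sy dy sorted dist] set_xs by simp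
      then have "ix (xs ! a) = s a" if "a < ?k" for a
        using that ixrx sN by (auto simp: ys_def)
      then show "\<forall>a<?k. \<forall>b<?k. snd (p (ix (xs ! a))) < snd (p (ix (xs ! b))) \<longleftrightarrow> \<pi> ! a < \<pi> ! b"
        using s(3) by simp
    qed
    finally show ?thesis .
  qed
  have "global_density \<pi> \<sigma> =
       real (card {S. S \<subseteq> {0..<N} \<and> card S = length \<pi> \<and> forms \<pi> S p}) / real (N choose length \<pi>)"
    if "\<pi> \<in> PermS" for \<pi>
  proof -
    have k: "length \<pi> \<ge> 1" and \<pi>: "is_perm \<pi>" using that by (auto simp: PermS_def)
    let ?A = "{S. S \<subseteq> {0..<N} \<and> card S = length \<pi> \<and> forms \<pi> S p}"
    let ?B = "{I \<in> {I. I \<subseteq> {0..<N} \<and> card I = length \<pi>}. pat_at \<sigma> I = \<pi>}"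
    have inj: "inj_on ((`) rx) ?A"
      by (rule inj_on_subset[OF inj_on_image_Pow]) (use rx(1) in \<open>auto simp: bij_betw_def\<close>)
    have "(`) rx ` ?A = ?B"
    proof
      have "card (rx ` S) = card S" if "S \<subseteq> {0..<N}" for S
        using that rx(1) by (intro card_image) (auto simp: bij_betw_def inj_on_subset)
      then show "(`) rx ` ?A \<subseteq> ?B" using pat[OF _ _ \<pi>] rxN by (auto simp: subset_iff)
      show "?B \<subseteq> (`) rx ` ?A"
      proof
        fix I assume I: "I \<in> ?B"
        then have IN: "i < N" if "i \<in> I" for i using that by auto
        have "(\<lambda>i. rx (ix i)) ` I = (\<lambda>i. i) ` I"
          by (rule image_cong) (simp_all add: IN rxix)
        then have "rx ` ix ` I = I" by (simp add: image_image)
        moreover have "ix ` I \<subseteq> {0..<N}" using IN rxix(2) by auto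
        moreover have "card (ix ` I) = card I"
          using I ix by (intro card_image) (auto simp: bij_betw_def intro: inj_on_subset)
        ultimately have "ix ` I \<in> ?A" using I pat[of "ix ` I" \<pi>] \<pi> by auto
        then show "I \<in> (`) rx ` ?A" using \<open>rx ` ix ` I = I\<close> by blast
      qed
    qed
    then have "card ?B = card ?A" using card_image[OF inj] by simp
    then show ?thesis
      unfolding global_density_def rho_def len windows_full[OF k] by (simp add: n_subsets)
  qed
  then show ?thesis using that perm len by blast
qed

section \<open>Independent points drawn from a permuton\<close>

context
  fixes \<Gamma> :: "(real \<times> real) measure"
  assumes permuton: "permuton \<Gamma>"
begin

interpretation \<Gamma>: prob_space \<Gamma>
  using permuton by (simp add: permuton_def)

lemma sets_permuton [measurable_cong]: "sets \<Gamma> = sets (borel \<Otimes>\<^sub>M borel)"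
  using permuton unfolding permuton_def by (metis borel_prod)

lemma space_permuton: "space \<Gamma> = UNIV"
  using sets_eq_imp_space_eq[OF sets_permuton] by (simp add: space_pair_measure)

text \<open>The uniform law has no atoms. This excludes ties between sampled coordinates, so that
  the ranks in both directions are bijections.\<close>

lemma permuton_fibre_null:
  shows "emeasure \<Gamma> {v. fst v = c} = 0" "emeasure \<Gamma> {v. snd v = c} = 0"
proof -
  have 0: "emeasure (uniform_measure lborel {0..1::real}) {c} = 0"
  proof -
    have "emeasure lborel ({0..1} \<inter> {c}) \<le> emeasure lborel {c}" by (rule emeasure_mono) auto
    then show ?thesis by (simp add: emeasure_uniform_measure)
  qed
  have "emeasure (distr \<Gamma> borel fst) {c} = emeasure \<Gamma> (fst -` {c} \<inter> space \<Gamma>)"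
    by (rule emeasure_distr) measurable
  moreover have "emeasure (distr \<Gamma> borel snd) {c} = emeasure \<Gamma> (snd -` {c} \<inter> space \<Gamma>)"
    by (rule emeasure_distr) measurable
  moreover have "fst -` {c} = {v :: real \<times> real. fst v = c}" "snd -` {c} = {v :: real \<times> real. snd v = c}"
    by auto
  ultimately show "emeasure \<Gamma> {v. fst v = c} = 0" "emeasure \<Gamma> {v. snd v = c} = 0"
    using permuton 0 by (simp_all add: permuton_def space_permuton)
qed

abbreviation sample :: "nat \<Rightarrow> (nat \<Rightarrow> real \<times> real) measure" where
  "sample N \<equiv> PiM {0..<N} (\<lambda>_. \<Gamma>)"

lemma prob_space_sample: "prob_space (sample N)"
  by (intro prob_space_PiM) unfold_locales

lemma indep_vars_sample:
  assumes "N > 0"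
  shows "prob_space.indep_vars (sample N) (\<lambda>_. \<Gamma>) (\<lambda>i \<omega>. \<omega> i) {0..<N}"
proof -
  interpret P: prob_space "sample N" by (rule prob_space_sample)
  show ?thesis
  proof (subst P.indep_vars_iff_distr_eq_PiM')
    have "distr (sample N) (sample N) (\<lambda>x. \<lambda>i\<in>{0..<N}. x i) = distr (sample N) (sample N) (\<lambda>x. x)"
      by (rule distr_cong) (auto simp: space_PiM PiE_def extensional_restrict)
    also have "\<dots> = sample N" by (rule distr_id)
    also have "\<dots> = PiM {0..<N} (\<lambda>i. distr (sample N) \<Gamma> (\<lambda>x. x i))"
      by (rule PiM_cong) (auto intro!: distr_PiM_component[symmetric] \<Gamma>.prob_space_axioms)
    finally show "distr (sample N) (sample N) (\<lambda>x. \<lambda>i\<in>{0..<N}. x i)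
      = PiM {0..<N} (\<lambda>i. distr (sample N) \<Gamma> (\<lambda>x. x i))" .
  qed (use assms in auto)
qed

text \<open>Two different coordinates of the sample have the product law of two copies of \<Gamma>.
  Every section of the event of a tie is a fibre of \<open>h\<close>, hence null, so the event is
  null by Fubini; there are finitely many pairs.\<close>

lemma AE_sample_distinct:
  fixes h :: "real \<times> real \<Rightarrow> real"
  assumes h [measurable]: "h \<in> borel_measurable \<Gamma>" and null: "\<And>c. emeasure \<Gamma> {v. h v = c} = 0"
  shows "AE \<omega> in sample N. inj_on (\<lambda>a. h (\<omega> a)) {0..<N}"
proof -
  interpret P: prob_space "sample N" by (rule prob_space_sample)
  have "AE \<omega> in sample N. h (\<omega> a) \<noteq> h (\<omega> b)" if ab: "a < N" "b < N" "a \<noteq> b" for a b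
  proof -
    let ?X = "\<lambda>i \<omega>. \<omega> i :: real \<times> real"
    have iv: "P.indep_var \<Gamma> (?X a) \<Gamma> (?X b)"
    proof -
      have "P.indep_vars (\<lambda>_. \<Gamma>) ?X {0..<N}" using ab by (intro indep_vars_sample) auto
      then have "P.indep_var (PiM {a} (\<lambda>_. \<Gamma>)) (\<lambda>\<omega>. restrict (\<lambda>i. \<omega> i) {a})
          (PiM {b} (\<lambda>_. \<Gamma>)) (\<lambda>\<omega>. restrict (\<lambda>i. \<omega> i) {b})"
        by (rule P.indep_var_restrict) (use ab in auto)
      from P.indep_var_compose[OF this, of "\<lambda>f. f a" \<Gamma> "\<lambda>f. f b" \<Gamma>] show ?thesis
        by (simp add: comp_def measurable_component_singleton)
    qed
    have dist: "distr (sample N) \<Gamma> (?X i) = \<Gamma>" if "i < N" for i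
      by (rule distr_PiM_component) (use that in \<open>auto intro: \<Gamma>.prob_space_axioms\<close>)
    have joint: "distr (sample N) (\<Gamma> \<Otimes>\<^sub>M \<Gamma>) (\<lambda>\<omega>. (\<omega> a, \<omega> b)) = \<Gamma> \<Otimes>\<^sub>M \<Gamma>"
      using iv unfolding P.indep_var_distribution_eq by (simp add: dist ab)
    let ?E = "{z \<in> space (\<Gamma> \<Otimes>\<^sub>M \<Gamma>). h (fst z) = h (snd z)}"
    have E: "?E \<in> sets (\<Gamma> \<Otimes>\<^sub>M \<Gamma>)" by measurable
    have "Pair x -` ?E = {v. h v = h x}" for x by (auto simp: space_pair_measure space_permuton)
    then have "emeasure (\<Gamma> \<Otimes>\<^sub>M \<Gamma>) ?E = 0"
      by (subst \<Gamma>.emeasure_pair_measure_alt[OF E]) (simp add: null)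
    then have "AE z in \<Gamma> \<Otimes>\<^sub>M \<Gamma>. h (fst z) \<noteq> h (snd z)"
      using E by (intro AE_I[of _ _ ?E]) auto
    then have "AE z in distr (sample N) (\<Gamma> \<Otimes>\<^sub>M \<Gamma>) (\<lambda>\<omega>. (\<omega> a, \<omega> b)). h (fst z) \<noteq> h (snd z)"
      by (simp only: joint)
    moreover have "(\<lambda>\<omega>. (\<omega> a, \<omega> b)) \<in> measurable (sample N) (\<Gamma> \<Otimes>\<^sub>M \<Gamma>)"
      using ab by (intro measurable_Pair measurable_component_singleton) auto
    ultimately have "AE \<omega> in sample N. h (fst (\<omega> a, \<omega> b)) \<noteq> h (snd (\<omega> a, \<omega> b))"
      by (rule AE_distrD[rotated])
    then show ?thesis by simp
  qed
  then have "AE \<omega> in sample N. \<forall>a\<in>{0..<N}. \<forall>b\<in>{0..<N}. a \<noteq> b \<longrightarrow> h (\<omega> a) \<noteq> h (\<omega> b)"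
    by (intro AE_finite_allI) auto
  then show ?thesis by eventually_elim (auto simp: inj_on_def)
qed

text \<open>Only the values of \<open>s\<close> below \<open>length \<pi>\<close> matter, so the
  existential ranges over a finite set of functions and the event is a finite Boolean combination of
  comparisons. The ambient index set \<open>A\<close> is free because the event is needed both in
  the full sample and in the product over \<open>S\<close> alone.\<close>

lemma forms_measurable:
  assumes SA: "S \<subseteq> A" and fin: "finite S"
  shows "Measurable.pred (PiM A (\<lambda>_. \<Gamma>)) (forms \<pi> S)"
proof -
  let ?k = "length \<pi>"
  let ?Q = "\<lambda>s (p :: nat \<Rightarrow> real \<times> real). \<forall>a\<in>{..<?k}. \<forall>b\<in>{..<?k}. (a < b \<longrightarrow> fst (p (s a)) < fst (p (s b))) \<and>
         (snd (p (s a)) < snd (p (s b)) \<longleftrightarrow> \<pi> ! a < \<pi> ! b)"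
  have "forms \<pi> S = (\<lambda>p. \<exists>s\<in>PiE {..<?k} (\<lambda>_. S). ?Q s p)"
  proof (intro ext iffI)
    fix p assume "forms \<pi> S p"
    then obtain s where "\<forall>a<?k. s a \<in> S" "?Q s p" unfolding forms_def by auto
    then show "\<exists>s\<in>PiE {..<?k} (\<lambda>_. S). ?Q s p"
      by (intro bexI[of _ "restrict s {..<?k}"]) auto
  next
    fix p assume "\<exists>s\<in>PiE {..<?k} (\<lambda>_. S). ?Q s p"
    then obtain s where "s \<in> PiE {..<?k} (\<lambda>_. S)" "?Q s p" by blast
    then show "forms \<pi> S p" unfolding forms_def by (intro exI[of _ s]) (auto dest: PiE_mem)
  qed
  moreover have "Measurable.pred (PiM A (\<lambda>_. \<Gamma>)) (\<lambda>p. \<exists>s\<in>PiE {..<?k} (\<lambda>_. S). ?Q s p)"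
  proof (rule pred_intros_finite(4))
    show "finite (PiE {..<?k} (\<lambda>_. S))" using fin by (intro finite_PiE) auto
    fix s assume s: "s \<in> PiE {..<?k} (\<lambda>_. S)"
    have coord: "(\<lambda>p. p (s a)) \<in> measurable (PiM A (\<lambda>_. \<Gamma>)) \<Gamma>" if "a < ?k" for a
      using s that SA by (intro measurable_component_singleton) (auto dest: PiE_mem)
    show "Measurable.pred (PiM A (\<lambda>_. \<Gamma>)) (?Q s)"
    proof (intro pred_intros_finite(3))
      fix a b assume "a \<in> {..<?k}" "b \<in> {..<?k}"
      then have ab: "a < ?k" "b < ?k" by auto
      have fs: "fst \<in> borel_measurable \<Gamma>" "snd \<in> borel_measurable \<Gamma>" by measurable
      have less: "Measurable.pred (PiM A (\<lambda>_. \<Gamma>)) (\<lambda>p. h (p (s a)) < h (p (s b)))"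
        if "h \<in> borel_measurable \<Gamma>" for h :: "real \<times> real \<Rightarrow> real"
        unfolding pred_def
        by (intro borel_measurable_less measurable_compose[OF coord[OF ab(1)] that]
            measurable_compose[OF coord[OF ab(2)] that])
      show "Measurable.pred (PiM A (\<lambda>_. \<Gamma>)) (\<lambda>p. (a < b \<longrightarrow> fst (p (s a)) < fst (p (s b))) \<and>
         (snd (p (s a)) < snd (p (s b)) \<longleftrightarrow> \<pi> ! a < \<pi> ! b))"
        using less[OF fs(1)] less[OF fs(2)] by (cases "a < b"; cases "\<pi> ! a < \<pi> ! b") simp_all
    qed auto
  qed
  ultimately show ?thesis by simp
qed

lemma sample_reindex:
  assumes S: "S \<subseteq> {0..<N}" "card S = k"
  shows "distr (sample N) (sample k) (\<lambda>\<omega>. \<lambda>a\<in>{0..<k}. \<omega> (sorted_list_of_set S ! a)) = sample k"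
proof (rule distr_PiM_reindex)
  have fin: "finite S" using S finite_subset by blast
  show "inj_on ((!) (sorted_list_of_set S)) {0..<k}"
    using S by (intro inj_on_nth) auto
  have "sorted_list_of_set S ! a \<in> S" if "a < k" for a
    using nth_mem[of a "sorted_list_of_set S"] that S fin by simp
  then show "(!) (sorted_list_of_set S) \<in> {0..<k} \<rightarrow> {0..<N}" using S by auto
qed (rule \<Gamma>.prob_space_axioms)

text \<open>The coordinates indexed by \<open>S\<close>, listed in increasing order of index, are
  again a sample of \<open>length \<pi>\<close> points, so the probability does not depend on
  \<open>S\<close>.\<close>

lemma prob_forms:
  assumes S: "S \<subseteq> {0..<N}" "card S = length \<pi>"
  shows "measure (sample N) {\<omega> \<in> space (sample N). forms \<pi> S \<omega>} = permuton_density \<pi> \<Gamma>"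
proof -
  let ?k = "length \<pi>" and ?xs = "sorted_list_of_set S"
  let ?t = "\<lambda>\<omega>. \<lambda>a\<in>{0..<?k}. \<omega> (?xs ! a) :: real \<times> real"
  have fin: "finite S" using S finite_subset by blast
  have im: "(!) ?xs ` {0..<?k} = S"
    using S fin nth_image[of ?k ?xs] by simp
  have eq: "forms \<pi> S \<omega> \<longleftrightarrow> forms \<pi> {0..<?k} (?t \<omega>)" for \<omega>
  proof -
    have "forms \<pi> S \<omega> \<longleftrightarrow> forms \<pi> {0..<?k} (\<omega> \<circ> (!) ?xs)" by (subst im[symmetric]) (rule forms_image)
    also have "\<dots> \<longleftrightarrow> forms \<pi> {0..<?k} (?t \<omega>)" by (rule forms_cong) simp
    finally show ?thesis .
  qed
  have "?xs ! a \<in> {0..<N}" if "a < ?k" for a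
  proof -
    have "?xs ! a \<in> (!) ?xs ` {0..<?k}" using that by (intro imageI) simp
    then show ?thesis using im S by blast
  qed
  then have t: "?t \<in> measurable (sample N) (sample ?k)"
    by (intro measurable_restrict measurable_component_singleton) auto
  have E: "pattern_event \<pi> \<inter> space (sample ?k) = {p \<in> space (sample ?k). forms \<pi> {0..<?k} p}"
    by (auto simp: pattern_event_eq_forms)
  have E_sets: "{p \<in> space (sample ?k). forms \<pi> {0..<?k} p} \<in> sets (sample ?k)"
    using forms_measurable[of "{0..<?k}" "{0..<?k}" \<pi>] by (simp add: pred_def)
  have "permuton_density \<pi> \<Gamma> = measure (distr (sample N) (sample ?k) ?t) {p \<in> space (sample ?k). forms \<pi> {0..<?k} p}"
    unfolding permuton_density_def E sample_reindex[OF S] ..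
  also have "\<dots> = measure (sample N) (?t -` {p \<in> space (sample ?k). forms \<pi> {0..<?k} p} \<inter> space (sample N))"
    by (rule measure_distr[OF t E_sets])
  also have "?t -` {p \<in> space (sample ?k). forms \<pi> {0..<?k} p} \<inter> space (sample N)
      = {\<omega> \<in> space (sample N). forms \<pi> S \<omega>}"
    using measurable_space[OF t] eq by auto
  finally show ?thesis by simp
qed

text \<open>Restrictions of the sample to disjoint index sets are independent, and
  \<open>prob_forms\<close> gives each factor.\<close>

lemma prob_forms_disjoint:
  assumes S: "S \<subseteq> {0..<N}" "card S = length \<pi>" and T: "T \<subseteq> {0..<N}" "card T = length \<pi>"
    and disj: "S \<inter> T = {}" and N: "N > 0"
  shows "measure (sample N) {\<omega> \<in> space (sample N). forms \<pi> S \<omega> \<and> forms \<pi> T \<omega>} = (permuton_density \<pi> \<Gamma>)\<^sup>2"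
proof -
  interpret P: prob_space "sample N" by (rule prob_space_sample)
  let ?E = "\<lambda>U. {p \<in> space (PiM U (\<lambda>_. \<Gamma>)). forms \<pi> U p}"
  have ind: "P.indep_var (PiM S (\<lambda>_. \<Gamma>)) (\<lambda>\<omega>. restrict (\<lambda>i. \<omega> i) S) (PiM T (\<lambda>_. \<Gamma>)) (\<lambda>\<omega>. restrict (\<lambda>i. \<omega> i) T)"
    by (rule P.indep_var_restrict[OF indep_vars_sample[OF N] disj S(1) T(1)])
  have E: "?E U \<in> sets (PiM U (\<lambda>_. \<Gamma>))" if "U \<subseteq> {0..<N}" for U
    using forms_measurable[of U U \<pi>] that finite_subset by (auto simp: pred_def)
  have pre: "(\<lambda>\<omega>. restrict (\<lambda>i. \<omega> i) U) -` ?E U \<inter> space (sample N) = {\<omega> \<in> space (sample N). forms \<pi> U \<omega>}"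
    for U
  proof -
    have "forms \<pi> U (restrict \<omega> U) \<longleftrightarrow> forms \<pi> U \<omega>" for \<omega> by (rule forms_cong) simp
    moreover have "restrict \<omega> U \<in> space (PiM U (\<lambda>_. \<Gamma>))" for \<omega> by (simp add: space_PiM space_permuton)
    ultimately show ?thesis by simp blast
  qed
  have "P.prob ((\<lambda>\<omega>. (restrict (\<lambda>i. \<omega> i) S, restrict (\<lambda>i. \<omega> i) T)) -` (?E S \<times> ?E T) \<inter> space (sample N))
    = P.prob ((\<lambda>\<omega>. restrict (\<lambda>i. \<omega> i) S) -` ?E S \<inter> space (sample N)) *
      P.prob ((\<lambda>\<omega>. restrict (\<lambda>i. \<omega> i) T) -` ?E T \<inter> space (sample N))"
    by (rule P.indep_varD[OF ind E[OF S(1)] E[OF T(1)]])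
  also have "\<dots> = (permuton_density \<pi> \<Gamma>)\<^sup>2"
    unfolding pre prob_forms[OF S] prob_forms[OF T] by (simp add: power2_eq_square)
  also have "(\<lambda>\<omega>. (restrict (\<lambda>i. \<omega> i) S, restrict (\<lambda>i. \<omega> i) T)) -` (?E S \<times> ?E T) \<inter> space (sample N)
    = ((\<lambda>\<omega>. restrict (\<lambda>i. \<omega> i) S) -` ?E S \<inter> space (sample N)) \<inter>
      ((\<lambda>\<omega>. restrict (\<lambda>i. \<omega> i) T) -` ?E T \<inter> space (sample N))" by blast
  also have "\<dots> = {\<omega> \<in> space (sample N). forms \<pi> S \<omega> \<and> forms \<pi> T \<omega>}"
    unfolding pre by blast
  finally show ?thesis .
qed

text \<open>The square of the centred average expands into pairs of k-subsets. Disjoint pairs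
  contribute 0 by independence and every other pair at most 1. Each subset meets at most k C(N - 1,
  k - 1) subsets, itself included, and dividing by C(N, k) leaves k^2 / N.\<close>

lemma density_second_moment:
  fixes \<pi> :: "nat list" and N :: nat
  defines "k \<equiv> length \<pi>"
  defines "Y \<equiv> \<lambda>\<omega>. real (card {S. S \<subseteq> {0..<N} \<and> card S = k \<and> forms \<pi> S \<omega>}) / real (N choose k)
    - permuton_density \<pi> \<Gamma>"
  assumes k: "1 \<le> k" "k \<le> N"
  shows "integrable (sample N) (\<lambda>\<omega>. (Y \<omega>)\<^sup>2)" "(\<integral>\<omega>. (Y \<omega>)\<^sup>2 \<partial>sample N) \<le> (real k)\<^sup>2 / real N"
proof -
  interpret P: prob_space "sample N" by (rule prob_space_sample)
  define p where "p = permuton_density \<pi> \<Gamma>"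
  define Sub where "Sub = {S. S \<subseteq> {0..<N} \<and> card S = k}"
  define E where "E S = {\<omega> \<in> space (sample N). forms \<pi> S \<omega>}" for S
  define d where "d S \<omega> = indicator (E S) \<omega> - p" for S \<omega>
  define C where "C = N choose k"
  have Sub: "S \<subseteq> {0..<N}" "card S = length \<pi>" "finite S" if "S \<in> Sub" for S
    using that finite_subset by (auto simp: Sub_def k_def)
  have finSub: "finite Sub" by (rule finite_subset[of _ "Pow {0..<N}"]) (auto simp: Sub_def)
  have cardSub: "card Sub = C" unfolding Sub_def C_def using n_subsets[of "{0..<N}" k] by simp
  have Cpos: "C > 0" using k by (simp add: C_def)
  have E_sets: "E S \<in> P.events" if "S \<in> Sub" for S
    using forms_measurable[OF Sub(1,3)[OF that]] by (simp add: E_def pred_def)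
  have E_prob: "P.prob (E S) = p" if "S \<in> Sub" for S
    unfolding E_def p_def using prob_forms[OF Sub(1,2)[OF that]] .
  obtain S0 where "S0 \<in> Sub" using finSub cardSub Cpos by fastforce
  then have p01: "0 \<le> p" "p \<le> 1" using E_prob[of S0] P.prob_le_1[of "E S0"] measure_nonneg[of "sample N" "E S0"] by auto
  have d_abs: "\<bar>d S \<omega>\<bar> \<le> 1" for S \<omega> using p01 by (auto simp: d_def indicator_def)
  have d_meas: "d S \<in> borel_measurable (sample N)" if "S \<in> Sub" for S
    unfolding d_def using E_sets[OF that] by (intro borel_measurable_diff) auto
  have dd_abs: "\<bar>d S \<omega> * d T \<omega>\<bar> \<le> 1" for S T \<omega>
    using mult_mono[OF d_abs[of S \<omega>] d_abs[of T \<omega>]] by (simp add: abs_mult)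
  have dd_int: "integrable (sample N) (\<lambda>\<omega>. d S \<omega> * d T \<omega>)" if "S \<in> Sub" "T \<in> Sub" for S T
    by (rule P.integrable_const_bound[of _ 1])
      (use dd_abs d_meas that in \<open>auto intro!: borel_measurable_times\<close>)
  have dd_le: "(\<integral>\<omega>. d S \<omega> * d T \<omega> \<partial>sample N) \<le> 1" if "S \<in> Sub" "T \<in> Sub" for S T
    by (rule P.integral_le_const[OF dd_int[OF that]]) (use dd_abs in \<open>auto simp: abs_le_iff\<close>)
  have dd_0: "(\<integral>\<omega>. d S \<omega> * d T \<omega> \<partial>sample N) = 0" if ST: "S \<in> Sub" "T \<in> Sub" "S \<inter> T = {}" for S T
  proof -
    have ES: "E S \<inter> E T = {\<omega> \<in> space (sample N). forms \<pi> S \<omega> \<and> forms \<pi> T \<omega>}"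
      by (auto simp: E_def)
    have "P.prob (E S \<inter> E T) = p\<^sup>2"
      unfolding ES p_def using k by (intro prob_forms_disjoint Sub ST) auto
    moreover have "(\<lambda>\<omega>. d S \<omega> * d T \<omega>) =
        (\<lambda>\<omega>. indicator (E S \<inter> E T) \<omega> - p * indicator (E S) \<omega> - p * indicator (E T) \<omega> + p\<^sup>2)"
      by (auto simp: d_def indicator_def power2_eq_square algebra_simps)
    moreover have "integrable (sample N) (indicator (E S \<inter> E T) :: _ \<Rightarrow> real)"
      "integrable (sample N) (indicator (E S) :: _ \<Rightarrow> real)"
      "integrable (sample N) (indicator (E T) :: _ \<Rightarrow> real)"
      using E_sets ST by (auto intro!: integrable_real_indicator simp: P.emeasure_eq_measure)
    ultimately show ?thesis
      using E_sets ST E_prob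
      by (simp add: P.prob_space power2_eq_square)
  qed
  \<comment> \<open>Union bound over a common element: the other k - 1 elements come from the
    remaining N - 1.\<close>
  have meet: "card {T \<in> Sub. S \<inter> T \<noteq> {}} \<le> k * ((N - 1) choose (k - 1))" if S: "S \<in> Sub" for S
  proof -
    let ?U = "\<lambda>i. insert i ` {T. T \<subseteq> {0..<N} - {i} \<and> card T = k - 1}"
    have "{T \<in> Sub. S \<inter> T \<noteq> {}} \<subseteq> (\<Union>i\<in>S. ?U i)"
    proof
      fix T assume T: "T \<in> {T \<in> Sub. S \<inter> T \<noteq> {}}"
      then obtain i where i: "i \<in> S" "i \<in> T" by blast
      have "T = insert i (T - {i})" "T - {i} \<subseteq> {0..<N} - {i}" "card (T - {i}) = k - 1"
        using T i Sub[of T] by (auto simp: k_def)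
      then show "T \<in> (\<Union>i\<in>S. ?U i)" using i(1) by blast
    qed
    then have "card {T \<in> Sub. S \<inter> T \<noteq> {}} \<le> card (\<Union>i\<in>S. ?U i)"
      by (rule card_mono[rotated]) (use Sub(3)[OF S] in auto)
    also have "\<dots> \<le> (\<Sum>i\<in>S. card (?U i))" by (rule card_UN_le[OF Sub(3)[OF S]])
    also have "\<dots> \<le> (\<Sum>i\<in>S. (N - 1) choose (k - 1))"
    proof (rule sum_mono)
      fix i assume "i \<in> S"
      then have "i < N" using Sub(1)[OF S] by auto
      then have "card {T. T \<subseteq> {0..<N} - {i} \<and> card T = k - 1} = (N - 1) choose (k - 1)"
        using n_subsets[of "{0..<N} - {i}" "k - 1"] by simp
      then show "card (?U i) \<le> (N - 1) choose (k - 1)"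
        using card_image_le[of "{T. T \<subseteq> {0..<N} - {i} \<and> card T = k - 1}" "insert i"] by simp
    qed
    also have "\<dots> = k * ((N - 1) choose (k - 1))" using Sub(2)[OF S] by (simp add: k_def)
    finally show ?thesis .
  qed
  have Y: "(Y \<omega>)\<^sup>2 = (\<Sum>S\<in>Sub. \<Sum>T\<in>Sub. d S \<omega> * d T \<omega>) / (real C)\<^sup>2" if "\<omega> \<in> space (sample N)" for \<omega>
  proof -
    have "{S. S \<subseteq> {0..<N} \<and> card S = k \<and> forms \<pi> S \<omega>} = {S \<in> Sub. \<omega> \<in> E S}"
      using that by (auto simp: Sub_def E_def)
    then have "real (card {S. S \<subseteq> {0..<N} \<and> card S = k \<and> forms \<pi> S \<omega>}) = (\<Sum>S\<in>Sub. indicator (E S) \<omega>)"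
      using finSub by (simp add: indicator_def sum.If_cases Int_def)
    then have "(\<Sum>S\<in>Sub. d S \<omega>) = real C * Y \<omega>"
      using Cpos cardSub by (simp add: d_def sum_subtractf Y_def C_def p_def right_diff_distrib)
    then have "(\<Sum>S\<in>Sub. \<Sum>T\<in>Sub. d S \<omega> * d T \<omega>) = (real C)\<^sup>2 * (Y \<omega>)\<^sup>2"
      by (simp add: power2_eq_square flip: sum_product)
    then show ?thesis using Cpos by simp
  qed
  have int: "integrable (sample N) (\<lambda>\<omega>. (\<Sum>S\<in>Sub. \<Sum>T\<in>Sub. d S \<omega> * d T \<omega>) / (real C)\<^sup>2)"
    using dd_int by (intro integrable_divide Bochner_Integration.integrable_sum) auto
  then show "integrable (sample N) (\<lambda>\<omega>. (Y \<omega>)\<^sup>2)"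
    by (subst Bochner_Integration.integrable_cong[OF refl Y])
  have "(\<integral>\<omega>. (Y \<omega>)\<^sup>2 \<partial>sample N) = (\<integral>\<omega>. (\<Sum>S\<in>Sub. \<Sum>T\<in>Sub. d S \<omega> * d T \<omega>) / (real C)\<^sup>2 \<partial>sample N)"
    by (rule Bochner_Integration.integral_cong[OF refl Y])
  also have "\<dots> = (\<Sum>S\<in>Sub. \<Sum>T\<in>Sub. \<integral>\<omega>. d S \<omega> * d T \<omega> \<partial>sample N) / (real C)\<^sup>2"
    using dd_int by (simp add: Bochner_Integration.integral_sum)
  also have "\<dots> \<le> (\<Sum>S\<in>Sub. \<Sum>T\<in>Sub. of_bool (S \<inter> T \<noteq> {})) / (real C)\<^sup>2"
    using dd_0 dd_le by (intro divide_right_mono sum_mono) auto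
  also have "\<dots> = (\<Sum>S\<in>Sub. real (card {T \<in> Sub. S \<inter> T \<noteq> {}})) / (real C)\<^sup>2"
    using finSub by (simp add: of_bool_def sum.If_cases Int_def)
  also have "\<dots> \<le> (\<Sum>S\<in>Sub. real (k * ((N - 1) choose (k - 1)))) / (real C)\<^sup>2"
    using meet by (intro divide_right_mono sum_mono) (simp_all only: of_nat_le_iff zero_le_power2)
  also have "\<dots> = real (k * ((N - 1) choose (k - 1))) / real C"
    using Cpos cardSub by (simp add: power2_eq_square)
  also have "\<dots> = (real k)\<^sup>2 / real N"
  proof -
    have "k * C = N * ((N - 1) choose (k - 1))" unfolding C_def using k by (intro times_binomial_minus1_eq) auto
    then have "real k * real C = real N * real ((N - 1) choose (k - 1))" by (metis of_nat_mult)
    then have "real k * (real k * real C) = real N * (real k * real ((N - 1) choose (k - 1)))" by simp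
    then show ?thesis using Cpos k by (simp add: power2_eq_square frac_eq_eq mult.commute mult.left_commute)
  qed
  finally show "(\<integral>\<omega>. (Y \<omega>)\<^sup>2 \<partial>sample N) \<le> (real k)\<^sup>2 / real N" .
qed

text \<open>Summing the squared deviations treats all patterns of \<open>\<P>\<close> at once: if
  the expected sum is below \<epsilon>^2, some sample without ties has sum below \<epsilon>^2, and
  this keeps every single deviation below \<epsilon>.\<close>

lemma permuton_approx_by_perm:
  assumes "finite \<P>" "\<P> \<subseteq> PermS" "\<epsilon> > 0"
  shows "eventually (\<lambda>N. \<exists>\<sigma>. is_perm \<sigma> \<and> length \<sigma> = N \<and>
    (\<forall>\<pi>\<in>\<P>. \<bar>global_density \<pi> \<sigma> - permuton_density \<pi> \<Gamma>\<bar> < \<epsilon>)) sequentially"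
proof -
  \<comment> \<open>By the second moment bound, the expected sum of squares is at most B / N, which
    is below \<epsilon>^2 once N > B / \<epsilon>^2.\<close>
  define B where "B = (\<Sum>\<pi>\<in>\<P>. (real (length \<pi>))\<^sup>2)"
  have "eventually (\<lambda>N. real N > B / \<epsilon>\<^sup>2) sequentially"
    using filterlim_real_sequentially by (simp add: filterlim_at_top_dense)
  moreover have "eventually (\<lambda>N. \<forall>\<pi>\<in>\<P>. length \<pi> \<le> N) sequentially"
    using assms(1) by (intro eventually_ball_finite ballI eventually_ge_at_top)
  ultimately show ?thesis using eventually_gt_at_top[of 0]
  proof eventually_elim
    case (elim N)
    interpret P: prob_space "sample N" by (rule prob_space_sample)
    define Y where "Y \<pi> \<omega> = real (card {S. S \<subseteq> {0..<N} \<and> card S = length \<pi> \<and> forms \<pi> S \<omega>}) /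
      real (N choose length \<pi>) - permuton_density \<pi> \<Gamma>" for \<pi> \<omega>
    have len: "1 \<le> length \<pi>" "length \<pi> \<le> N" if "\<pi> \<in> \<P>" for \<pi>
      using that assms(2) elim by (auto simp: PermS_def)
    have int: "integrable (sample N) (\<lambda>\<omega>. (Y \<pi> \<omega>)\<^sup>2)" if "\<pi> \<in> \<P>" for \<pi>
      unfolding Y_def by (rule density_second_moment(1)[OF len[OF that]])
    have le: "(\<integral>\<omega>. (Y \<pi> \<omega>)\<^sup>2 \<partial>sample N) \<le> (real (length \<pi>))\<^sup>2 / real N" if "\<pi> \<in> \<P>" for \<pi>
      unfolding Y_def by (rule density_second_moment(2)[OF len[OF that]])
    have "(\<integral>\<omega>. (\<Sum>\<pi>\<in>\<P>. (Y \<pi> \<omega>)\<^sup>2) \<partial>sample N) = (\<Sum>\<pi>\<in>\<P>. \<integral>\<omega>. (Y \<pi> \<omega>)\<^sup>2 \<partial>sample N)"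
      using int by (rule Bochner_Integration.integral_sum)
    also have "\<dots> \<le> (\<Sum>\<pi>\<in>\<P>. (real (length \<pi>))\<^sup>2 / real N)" using le by (rule sum_mono)
    also have "\<dots> = B / real N" by (simp add: B_def sum_divide_distrib)
    also have "\<dots> < \<epsilon>\<^sup>2" using elim assms(3) by (simp add: field_simps)
    finally have small: "(\<integral>\<omega>. (\<Sum>\<pi>\<in>\<P>. (Y \<pi> \<omega>)\<^sup>2) \<partial>sample N) < \<epsilon>\<^sup>2" .
    have distinct: "AE \<omega> in sample N. inj_on (\<lambda>a. fst (\<omega> a)) {0..<N} \<and> inj_on (\<lambda>a. snd (\<omega> a)) {0..<N}"
      using AE_sample_distinct[of fst N] AE_sample_distinct[of snd N] permuton_fibre_null by simp
    have "\<exists>\<omega>. inj_on (\<lambda>a. fst (\<omega> a)) {0..<N} \<and> inj_on (\<lambda>a. snd (\<omega> a)) {0..<N} \<and>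
      (\<Sum>\<pi>\<in>\<P>. (Y \<pi> \<omega>)\<^sup>2) < \<epsilon>\<^sup>2"
    proof (rule ccontr)
      assume neg: "\<not> ?thesis"
      have "AE \<omega> in sample N. \<epsilon>\<^sup>2 \<le> (\<Sum>\<pi>\<in>\<P>. (Y \<pi> \<omega>)\<^sup>2)"
        using distinct by (rule eventually_mono) (use neg in \<open>auto simp: not_less\<close>)
      then have "\<epsilon>\<^sup>2 \<le> (\<integral>\<omega>. (\<Sum>\<pi>\<in>\<P>. (Y \<pi> \<omega>)\<^sup>2) \<partial>sample N)"
        using int by (intro P.integral_ge_const Bochner_Integration.integrable_sum)
      then show False using small by simp
    qed
    then obtain \<omega> where \<omega>: "inj_on (\<lambda>a. fst (\<omega> a)) {0..<N}" "inj_on (\<lambda>a. snd (\<omega> a)) {0..<N}"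
      "(\<Sum>\<pi>\<in>\<P>. (Y \<pi> \<omega>)\<^sup>2) < \<epsilon>\<^sup>2" by blast
    obtain \<sigma> where \<sigma>: "is_perm \<sigma>" "length \<sigma> = N"
      "\<And>\<pi>. \<pi> \<in> PermS \<Longrightarrow> global_density \<pi> \<sigma> =
         real (card {S. S \<subseteq> {0..<N} \<and> card S = length \<pi> \<and> forms \<pi> S \<omega>}) / real (N choose length \<pi>)"
      using perm_of_points[OF \<omega>(1,2)] by blast
    have "\<bar>global_density \<pi> \<sigma> - permuton_density \<pi> \<Gamma>\<bar> < \<epsilon>" if "\<pi> \<in> \<P>" for \<pi>
    proof -
      have "(Y \<pi> \<omega>)\<^sup>2 \<le> (\<Sum>\<pi>\<in>\<P>. (Y \<pi> \<omega>)\<^sup>2)"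
        using that assms(1) by (intro member_le_sum) auto
      then have "(Y \<pi> \<omega>)\<^sup>2 < \<epsilon>\<^sup>2" using \<omega>(3) by simp
      then have "\<bar>Y \<pi> \<omega>\<bar> < \<epsilon>" using assms(3) power2_less_imp_less[of "\<bar>Y \<pi> \<omega>\<bar>" \<epsilon>] by simp
      then show ?thesis using \<sigma>(3) that assms(2) by (auto simp: Y_def)
    qed
    then show ?case using \<sigma> by blast
  qed
qed

end

subsection \<open>Most windows are lifted windows\<close>

text \<open>The right-hand side is (d + 1) ... (d + s), a product of s factors larger than
  d.\<close>

lemma power_le_fact_mult_binomial: "d ^ s \<le> fact s * ((d + s) choose s)" for d s :: nat
proof (induction s)
  case (Suc s)
  have "d ^ Suc s \<le> (d + Suc s) * d ^ s" by (simp add: add_mult_distrib)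
  also have "\<dots> \<le> (d + Suc s) * (fact s * ((d + s) choose s))" using Suc by (intro mult_left_mono) auto
  also have "\<dots> = fact s * (Suc (d + s) * ((d + s) choose s))"
    by (simp only: add_Suc_right mult.left_commute)
  also have "\<dots> = fact s * (Suc s * (Suc (d + s) choose Suc s))" by (simp only: Suc_times_binomial)
  also have "\<dots> = fact (Suc s) * ((d + Suc s) choose Suc s)" by (simp add: algebra_simps)
  finally show ?case .
qed simp

lemma binomial_ge_power_over_fact:
  assumes "s \<le> n"
  shows "real (n - s) ^ s / fact s \<le> real (n choose s)"
proof -
  have "(n - s) ^ s \<le> fact s * (n choose s)"
    using power_le_fact_mult_binomial[of "n - s" s] assms by simp
  then have "real ((n - s) ^ s) \<le> real (fact s * (n choose s))" by (rule of_nat_mono)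
  then show ?thesis by (simp add: field_simps)
qed

lemma binomial_le_power_over_fact: "real (n choose s) \<le> real n ^ s / fact s"
proof -
  have "real ((n choose s) * fact s) \<le> real (n ^ s)" by (rule of_nat_mono[OF binomial_fact_pow])
  then show ?thesis by (simp add: field_simps)
qed

lemma of_nat_div_ge:
  assumes "N > 0"
  shows "real n / real N - 1 \<le> real (n div N)"
proof -
  have "n mod N \<le> N" using assms by (simp add: less_imp_le)
  then have "n \<le> n div N * N + N" using div_mult_mod_eq[of n N] by linarith
  then have "real n \<le> real (n div N * N + N)" by (rule of_nat_mono)
  then show ?thesis using assms by (simp add: field_simps)
qed

text \<open>Rounding losses enter as a factor \<open>h n\<close> that tends to 1; a strict
  inequality for the limiting proportion \<open>c\<close> absorbs them for large n.\<close>

lemma eventually_mult_ge: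
  fixes h :: "nat \<Rightarrow> real"
  assumes "h \<longlonglongrightarrow> 1" "a < c"
  shows "eventually (\<lambda>n. a \<le> h n * c) sequentially"
proof -
  have "(\<lambda>n. h n * c) \<longlonglongrightarrow> 1 * c" using assms(1) by (intro tendsto_mult tendsto_const)
  then show ?thesis using assms(2) by (auto dest!: order_tendstoD(1)[of _ _ _ a] elim: eventually_mono)
qed

text \<open>With blocks of length 1 the losses are the incomplete last copy, paid by the factor 1 -
  N / n, and the windows that straddle two copies, paid by the factor 1 - k / N.\<close>

lemma most_windows_local:
  assumes k: "1 \<le> k" "k \<le> N" and le1: "\<epsilon> \<le> 1" and \<epsilon>: "1 - \<epsilon> < 1 - real k / real N"
  shows "eventually (\<lambda>n. (1 - \<epsilon>) * real (card (windows (real k) k n))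
    \<le> real ((n div N) * card (windows (real k) k N) * 1 ^ k)) sequentially"
proof -
  have "(\<lambda>n. 1 - real N * (1 / real n)) \<longlonglongrightarrow> 1 - real N * 0"
    by (intro tendsto_intros lim_1_over_n)
  then have "eventually (\<lambda>n. 1 - \<epsilon> \<le> (1 - real N * (1 / real n)) * (1 - real k / real N)) sequentially"
    using \<epsilon> by (intro eventually_mult_ge) auto
  then show ?thesis using eventually_gt_at_top[of 0]
  proof eventually_elim
    case (elim n)
    have N: "real N > 0" using k by simp
    have W: "real (card (windows (real k) k n)) \<le> real n"
      using card_windows_le[OF k(1), of k n] by simp
    have V: "real N - real k \<le> real (card (windows (real k) k N))"
      using card_windows_ge[OF k(1) k(1) k(2)] k by simp
    have q: "real n / real N - 1 \<le> real (n div N)" using k by (intro of_nat_div_ge) auto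
    have "(1 - \<epsilon>) * real (card (windows (real k) k n)) \<le> (1 - \<epsilon>) * real n"
      using W le1 by (intro mult_left_mono) auto
    also have "\<dots> \<le> ((1 - real N * (1 / real n)) * (1 - real k / real N)) * real n"
      using elim by (intro mult_right_mono) auto
    also have "\<dots> = (real n / real N - 1) * (real N - real k)" using elim N by (simp add: field_simps)
    also have "\<dots> \<le> real (n div N) * (real N - real k)" using q k by (intro mult_right_mono) auto
    also have "\<dots> \<le> real (n div N) * real (card (windows (real k) k N))" using V by (intro mult_left_mono) auto
    finally show ?case by simp
  qed
qed

text \<open>With one copy and block length n div N, rounding is paid by (1 - N / n)^k. The factor (1
  - k / N)^k pays for subsets with two points in one block: it compares the lower bound (N - k)^k /
  k! for C(N, k) with N^k / k!.\<close>

lemma most_windows_global: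
  assumes k: "1 \<le> k" "k \<le> N" and le1: "\<epsilon> \<le> 1" and \<epsilon>: "1 - \<epsilon> < (1 - real k / real N) ^ k"
  shows "eventually (\<lambda>n. (1 - \<epsilon>) * real (card (windows (real n) k n))
    \<le> real (1 * card (windows (real N) k N) * (n div N) ^ k)) sequentially"
proof -
  have "(\<lambda>n. (1 - real N * (1 / real n)) ^ k) \<longlonglongrightarrow> (1 - real N * 0) ^ k"
    by (intro tendsto_intros lim_1_over_n)
  then have "eventually (\<lambda>n. 1 - \<epsilon> \<le> (1 - real N * (1 / real n)) ^ k * (1 - real k / real N) ^ k) sequentially"
    using \<epsilon> by (intro eventually_mult_ge) auto
  then show ?thesis using eventually_ge_at_top[of N]
  proof eventually_elim
    case (elim n)
    have N: "real N > 0" and n: "real n > 0" using k elim by simp_all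
    have W: "real (card (windows (real n) k n)) \<le> real n ^ k / fact k"
      unfolding windows_full[OF k(1)] using n_subsets[of "{0..<n}" k] binomial_le_power_over_fact by simp
    have V: "(real N - real k) ^ k / fact k \<le> real (card (windows (real N) k N))"
      unfolding windows_full[OF k(1)]
      using n_subsets[of "{0..<N}" k] binomial_ge_power_over_fact[OF k(2)] k by (simp add: of_nat_diff)
    have q: "real n / real N - 1 \<le> real (n div N)" using k by (intro of_nat_div_ge) auto
    have q0: "0 \<le> real n / real N - 1" using elim N by (simp add: field_simps)
    have "(1 - \<epsilon>) * real (card (windows (real n) k n)) \<le> (1 - \<epsilon>) * (real n ^ k / fact k)"
      using W le1 by (intro mult_left_mono) auto
    also have "\<dots> \<le> ((1 - real N * (1 / real n)) ^ k * (1 - real k / real N) ^ k) * (real n ^ k / fact k)"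
      using elim by (intro mult_right_mono) auto
    also have "\<dots> = ((1 - real N * (1 / real n)) * (1 - real k / real N) * real n) ^ k / fact k"
      by (simp add: power_mult_distrib)
    also have "(1 - real N * (1 / real n)) * (1 - real k / real N) * real n
        = (real n / real N - 1) * (real N - real k)" using n N by (simp add: field_simps)
    also have "((real n / real N - 1) * (real N - real k)) ^ k / fact k
        = (real n / real N - 1) ^ k * ((real N - real k) ^ k / fact k)" by (simp add: power_mult_distrib)
    also have "\<dots> \<le> real (n div N) ^ k * real (card (windows (real N) k N))"
      using q q0 V k by (intro mult_mono power_mono) auto
    finally show ?case by (simp add: mult.commute)
  qed
qed

text \<open>The limiting proportion has two sources. The factor 1 - w / N pays for windows that
  leave their copy. The power compares the choices of k - 1 further blocks and offsets, at least (w
  - k)^(k - 1) b^(k - 1) / (k - 1)!, with the choices of k - 1 further positions in a window, at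
  most ((w + 1) b)^(k - 1) / (k - 1)!. The exponent is k - 1 because the minimum is counted
  separately.\<close>

lemma most_windows_scale:
  fixes F :: "nat \<Rightarrow> real"
  assumes F: "filterlim F at_top sequentially" "(\<lambda>n. F n / real n) \<longlonglongrightarrow> 0"
    and k: "1 \<le> k" "k \<le> w" "w \<le> N"
    and le1: "\<epsilon> \<le> 1" and \<epsilon>: "1 - \<epsilon> < (1 - real w / real N) * ((real w - real k) / (real w + 1)) ^ (k - 1)"
  shows "eventually (\<lambda>n. (1 - \<epsilon>) * real (card (windows (real (nat \<lfloor>F n\<rfloor>)) k n))
    \<le> real ((n div (N * nat \<lfloor>F n / real w\<rfloor>)) * card (windows (real w) k N) * nat \<lfloor>F n / real w\<rfloor> ^ k)) sequentially"
proof -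
  define c where "c = (1 - real w / real N) * ((real w - real k) / (real w + 1)) ^ (k - 1)"
  define b where "b n = nat \<lfloor>F n / real w\<rfloor>" for n
  have w: "real w > 0" and N: "real N > 0" using k by simp_all
  \<comment> \<open>The complete copies miss fewer than N b positions, where b \<le> F n / w is the
    block length; relative to n this loses at most (N / w) (F n / n).\<close>
  have "(\<lambda>n. 1 - (real N / real w) * (F n / real n)) \<longlonglongrightarrow> 1 - (real N / real w) * 0"
    by (intro tendsto_intros F)
  then have "eventually (\<lambda>n. 1 - \<epsilon> \<le> (1 - (real N / real w) * (F n / real n)) * c) sequentially"
    using \<epsilon> by (intro eventually_mult_ge) (auto simp: c_def)
  \<comment> \<open>This makes the block length b larger than \<open>w\<close>, so that F n < w b +
    w \<le> (w + 1) b: the w + 1 in the denominator pays for rounding b down.\<close>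
  moreover have "eventually (\<lambda>n. real w * (real w + 1) \<le> F n) sequentially"
    using F(1) by (simp add: filterlim_at_top)
  ultimately show ?thesis using eventually_gt_at_top[of 0] unfolding b_def[symmetric]
  proof eventually_elim
    case (elim n)
    let ?m = "nat \<lfloor>F n\<rfloor>" and ?q = "n div (N * b n)"
    have n: "real n > 0" using elim by simp
    have F0: "0 \<le> F n" using elim w by (smt (verit) mult_nonneg_nonneg)
    have b_le: "real (b n) \<le> F n / real w" using F0 w by (simp add: b_def)
    have b_ge: "F n / real w < real (b n) + 1"
      using F0 w real_of_int_floor_add_one_gt[of "F n / real w"] by (simp add: b_def)
    have "real w + 1 \<le> F n / real w" using elim w by (simp add: field_simps)
    then have bw: "real w < real (b n)" using b_ge by linarith
    then have b0: "real (b n) > 0" using w by linarith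
    have "F n < real w * real (b n) + real w" using b_ge w by (simp add: field_simps)
    then have Fb: "F n \<le> (real w + 1) * real (b n)" using bw by (simp add: algebra_simps)
    have m: "real (?m - 1) \<le> (real w + 1) * real (b n)"
    proof -
      have "real (?m - 1) \<le> real ?m" by simp
      also have "\<dots> \<le> F n" using F0 by simp
      finally show ?thesis using Fb by linarith
    qed
    define D where "D = ((real w + 1) * real (b n)) ^ (k - 1) / fact (k - 1)"
    have D0: "D \<ge> 0" using w b0 by (simp add: D_def)
    have "real (card (windows (real ?m) k n)) \<le> real (n * ((?m - 1) choose (k - 1)))"
      by (rule of_nat_mono[OF card_windows_le[OF k(1)]])
    also have "\<dots> = real n * real ((?m - 1) choose (k - 1))" by simp
    also have "\<dots> \<le> real n * (real (?m - 1) ^ (k - 1) / fact (k - 1))"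
      by (intro mult_left_mono binomial_le_power_over_fact) simp
    also have "\<dots> \<le> real n * D"
      unfolding D_def using m by (intro mult_left_mono divide_right_mono power_mono) auto
    finally have W: "real (card (windows (real ?m) k n)) \<le> real n * D" .
    have V: "(real N - real w) * ((real w - real k) ^ (k - 1) / fact (k - 1)) \<le> real (card (windows (real w) k N))"
    proof -
      have "w - 1 - (k - 1) = w - k" using k by simp
      then have "(real w - real k) ^ (k - 1) / fact (k - 1) \<le> real ((w - 1) choose (k - 1))"
        using binomial_ge_power_over_fact[of "k - 1" "w - 1"] k by (simp add: of_nat_diff)
      then have "(real N - real w) * ((real w - real k) ^ (k - 1) / fact (k - 1))
          \<le> real (N - w + 1) * real ((w - 1) choose (k - 1))"
        using k by (intro mult_mono) (auto simp: of_nat_diff)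
      also have "\<dots> = real ((N - w + 1) * ((w - 1) choose (k - 1)))" by (simp only: of_nat_mult)
      also have "\<dots> \<le> real (card (windows (real w) k N))"
        using k by (intro of_nat_mono card_windows_ge) auto
      finally show ?thesis .
    qed
    have q: "real n - real N * real (b n) \<le> real ?q * real (b n) * real N"
      using of_nat_div_ge[of "N * b n" n] N b0 by (simp add: field_simps)
    have q': "(1 - (real N / real w) * (F n / real n)) * real n \<le> real n - real N * real (b n)"
    proof -
      have "real N * real (b n) \<le> real N * (F n / real w)" using b_le by (intro mult_left_mono) auto
      then show ?thesis using n by (simp add: algebra_simps)
    qed
    have kk: "real (b n) ^ k = real (b n) * real (b n) ^ (k - 1)"
      using k(1) by (metis power_eq_if not_one_le_zero)
    have c0: "c \<ge> 0" unfolding c_def using k w N by (intro mult_nonneg_nonneg zero_le_power) (auto simp: field_simps)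
    have "(1 - \<epsilon>) * real (card (windows (real ?m) k n)) \<le> (1 - \<epsilon>) * (real n * D)"
      using W le1 by (intro mult_left_mono) auto
    also have "\<dots> \<le> (1 - (real N / real w) * (F n / real n)) * c * (real n * D)"
      using elim D0 by (intro mult_right_mono) auto
    also have "\<dots> = ((1 - (real N / real w) * (F n / real n)) * real n) * (c * D)" by simp
    also have "\<dots> \<le> (real ?q * real (b n) * real N) * (c * D)"
      using q q' c0 D0 by (intro mult_right_mono) auto
    also have "\<dots> = (real ?q * real (b n) ^ k) * ((real N * (1 - real w / real N)) *
        ((((real w - real k) / (real w + 1)) ^ (k - 1) * (real w + 1) ^ (k - 1)) / fact (k - 1)))"
      unfolding c_def D_def kk power_mult_distrib by simp
    also have "real N * (1 - real w / real N) = real N - real w" using N by (simp add: field_simps)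
    also have "((real w - real k) / (real w + 1)) ^ (k - 1) * (real w + 1) ^ (k - 1) = (real w - real k) ^ (k - 1)"
      using w by (simp flip: power_mult_distrib)
    also have "(real ?q * real (b n) ^ k) * ((real N - real w) * ((real w - real k) ^ (k - 1) / fact (k - 1)))
        \<le> (real ?q * real (b n) ^ k) * real (card (windows (real w) k N))"
      using V by (intro mult_left_mono) auto
    finally show ?case by (simp add: mult.commute mult.left_commute)
  qed
qed

subsection \<open>Systems of levels\<close>

text \<open>Levels \<open>0\<close> and \<open>Suc L\<close> encode the local and the global behaviour, with \<open>F 0 = 1\<close> and
  \<open>F (Suc L) n = n\<close>; the levels in between belong to the scaling functions.\<close>

locale level_system =
  fixes L :: nat and F :: "nat \<Rightarrow> nat \<Rightarrow> real" and \<sigma> :: "nat \<Rightarrow> nat list" and w :: "nat \<Rightarrow> nat"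
  assumes F_0: "F 0 n = 1" and F_top: "F (Suc L) n = real n"
    and F_scaling: "\<And>l. 1 \<le> l \<Longrightarrow> l \<le> L \<Longrightarrow> scaling_function (F l)"
    and F_dominated: "\<And>l s. 1 \<le> l \<Longrightarrow> l < s \<Longrightarrow> s \<le> L \<Longrightarrow> dominated (F l) (F s)"
    and \<sigma>_perm: "\<And>l. l \<le> Suc L \<Longrightarrow> is_perm (\<sigma> l)"
    and w_pos: "\<And>l. l \<le> Suc L \<Longrightarrow> 1 \<le> w l \<and> w l \<le> length (\<sigma> l)"
    and w_0: "w 0 = 1" and w_top: "w (Suc L) = length (\<sigma> (Suc L))"
begin

text \<open>\<open>w l\<close> blocks make up a window of the scale, up to rounding. At level 0 the
  value \<open>w 0 = 1\<close> serves to make the blocks singletons; the windows there have the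
  width \<open>length \<pi>\<close>. At the top level a single copy of the permutation fills all n
  positions, up to rounding.\<close>

definition block :: "nat \<Rightarrow> nat \<Rightarrow> nat" where
  "block l n = nat \<lfloor>F l n / real (w l)\<rfloor>"

lemma block_0: "block 0 n = 1"
  by (simp add: block_def F_0 w_0)

lemma block_top: "block (Suc L) n = n div length (\<sigma> (Suc L))"
  by (simp add: block_def F_top w_top floor_divide_of_nat_eq)

lemma F_at_top: "1 \<le> l \<Longrightarrow> l \<le> Suc L \<Longrightarrow> filterlim (F l) at_top sequentially"
proof (cases "l = Suc L")
  case True
  then have "F l = real" using F_top by auto
  then show ?thesis using filterlim_real_sequentially by simp
qed (use F_scaling in \<open>auto simp: scaling_function_def\<close>)

lemma F_bounds: "l \<le> Suc L \<Longrightarrow> n \<ge> 1 \<Longrightarrow> 0 < F l n \<and> F l n \<le> real n"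
  using F_scaling[of l] by (cases "l = 0"; cases "l = Suc L") (auto simp: F_0 F_top scaling_function_def)

text \<open>The two added levels fit into the chain: a function tending to infinity dominates the
  constant 1, and f(n) / n tends to 0 for a scaling function.\<close>

lemma F_dominated_all:
  assumes "l < s" "s \<le> Suc L"
  shows "(\<lambda>n. F l n / F s n) \<longlonglongrightarrow> 0"
proof (cases "l = 0")
  case True
  have "filterlim (F s) at_top sequentially" using assms by (intro F_at_top) auto
  then show ?thesis
    using True tendsto_inverse_0_at_top[of "F s" sequentially] by (simp add: F_0 inverse_eq_divide)
next
  case l: False
  show ?thesis
  proof (cases "s = Suc L")
    case True
    then show ?thesis using F_scaling[of l] l assms by (simp add: F_top scaling_function_def)
  qed (use F_dominated[of l s] l assms in \<open>auto simp: dominated_def\<close>)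
qed

text \<open>Blocks of a coarser level are shorter than \<open>F s\<close> only by the fixed factor
  \<open>w s\<close>, so they outgrow every multiple of a finer scale. Half of F s n / w s pays for
  rounding down, which is why F s n \<ge> 2 w s is requested.\<close>

lemma eventually_le_block:
  assumes ls: "l < s" "s \<le> Suc L" and c: "c > 0"
  shows "eventually (\<lambda>n. c * F l n \<le> real (block s n)) sequentially"
proof -
  have w: "real (w s) > 0" using w_pos[OF ls(2)] by simp
  have "eventually (\<lambda>n. F l n / F s n < 1 / (2 * c * real (w s))) sequentially"
    using order_tendstoD(2)[OF F_dominated_all[OF ls]] c w by simp
  moreover have "eventually (\<lambda>n. 2 * real (w s) \<le> F s n) sequentially"
    using F_at_top[of s] ls by (simp add: filterlim_at_top)
  ultimately show ?thesis
  proof eventually_elim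
    case (elim n)
    then have F: "F s n > 0" using w by linarith
    have "c * F l n \<le> F s n / (2 * real (w s))" using elim(1) F c w by (simp add: field_simps)
    also have "\<dots> \<le> F s n / real (w s) - 1" using elim(2) w by (simp add: field_simps)
    also have "\<dots> \<le> real (block s n)" unfolding block_def by linarith
    finally show ?case .
  qed
qed

lemma block_le: "l \<le> Suc L \<Longrightarrow> n \<ge> 1 \<Longrightarrow> block l n \<le> n"
proof -
  assume l: "l \<le> Suc L" and n: "n \<ge> 1"
  have "F l n / real (w l) \<le> F l n / 1"
    using F_bounds[OF l n] w_pos[OF l] by (intro divide_left_mono) auto
  then have "F l n / real (w l) \<le> real n" using F_bounds[OF l n] by simp
  then show ?thesis unfolding block_def by linarith
qed

lemma few_windows_crossing:
  fixes m :: "nat \<Rightarrow> nat"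
  assumes l: "l \<le> Suc L" and k: "1 \<le> k" and \<epsilon>: "\<epsilon> > 0"
    and m: "eventually (\<lambda>n. 1 \<le> m n \<and> real (m n) \<le> c * F l n) sequentially"
  shows "eventually (\<lambda>n. real (card (windows (real (m n)) k n \<inter> (\<Union>s\<in>{l<..Suc L}. crossing (block s n))))
    \<le> \<epsilon> * real (card (windows (real (m n)) k n))) sequentially"
proof -
  \<comment> \<open>The tolerance is shared among the coarser levels, of which there are at most
    \<open>Suc L\<close>.\<close>
  define \<delta> where "\<delta> = \<epsilon> / real (Suc L)"
  define C where "C = max c 1"
  have \<delta>: "\<delta> > 0" using \<epsilon> by (simp add: \<delta>_def)
  have C: "C > 0" "c \<le> C" by (auto simp: C_def)
  have "eventually (\<lambda>n. real (card (windows (real (m n)) k n \<inter> crossing (block s n)))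
      \<le> \<delta> * real (card (windows (real (m n)) k n))) sequentially" if s: "s \<in> {l<..Suc L}" for s
  proof -
    have "eventually (\<lambda>n. 4 * C / \<delta> * F l n \<le> real (block s n)) sequentially"
      using s \<delta> C by (intro eventually_le_block) auto
    \<comment> \<open>The top level is consulted to obtain 2 m(n) \<le> n; it lies strictly above
      \<open>l\<close> because \<open>s\<close> does.\<close>
    moreover have "eventually (\<lambda>n. 2 * C * F l n \<le> real (block (Suc L) n)) sequentially"
      using s \<delta> C by (intro eventually_le_block) auto
    ultimately show ?thesis using m eventually_ge_at_top[of 1]
    proof eventually_elim
      case (elim n)
      have "c * F l n \<le> C * F l n" using C F_bounds[OF l, of n] elim by (intro mult_right_mono) auto
      then have mC: "real (m n) \<le> C * F l n" using elim by linarith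
      have 1: "4 * real (m n) \<le> \<delta> * real (block s n)"
      proof -
        have "4 * C * F l n \<le> \<delta> * real (block s n)" using elim(1) \<delta> by (simp add: field_simps)
        then show ?thesis using mC by linarith
      qed
      have "2 * real (m n) \<le> real (block (Suc L) n)" using elim(2) mC by linarith
      also have "\<dots> \<le> real n" using block_le[of "Suc L" n] elim by simp
      finally have 2: "2 * m n \<le> n" by linarith
      have "0 < \<delta> * real (block s n)" using 1 elim by linarith
      then have "0 < block s n" using \<delta> by (simp add: zero_less_mult_iff)
      then show ?case
        using elim 1 2 k block_le[of s n] s by (intro card_windows_crossing_le) auto
    qed
  qed
  then have "eventually (\<lambda>n. \<forall>s\<in>{l<..Suc L}. real (card (windows (real (m n)) k n \<inter> crossing (block s n)))
      \<le> \<delta> * real (card (windows (real (m n)) k n))) sequentially"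
    by (intro eventually_ball_finite ballI) auto
  then show ?thesis
  proof eventually_elim
    case (elim n)
    let ?W = "windows (real (m n)) k n"
    have "card (?W \<inter> (\<Union>s\<in>{l<..Suc L}. crossing (block s n))) = card (\<Union>s\<in>{l<..Suc L}. ?W \<inter> crossing (block s n))"
      by (simp only: Int_UN_distrib)
    also have "\<dots> \<le> (\<Sum>s\<in>{l<..Suc L}. card (?W \<inter> crossing (block s n)))"
      by (rule card_UN_le) simp
    finally have "real (card (?W \<inter> (\<Union>s\<in>{l<..Suc L}. crossing (block s n))))
        \<le> (\<Sum>s\<in>{l<..Suc L}. real (card (?W \<inter> crossing (block s n))))"
      unfolding of_nat_sum[symmetric] by (rule of_nat_mono)
    also have "\<dots> \<le> (\<Sum>s\<in>{l<..Suc L}. \<delta> * real (card ?W))" using elim by (intro sum_mono) auto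
    also have "\<dots> = real (Suc L - l) * (\<delta> * real (card ?W))" by simp
    also have "\<dots> \<le> real (Suc L) * (\<delta> * real (card ?W))" using \<delta> by (intro mult_right_mono) auto
    also have "\<dots> = \<epsilon> * real (card ?W)" by (simp add: \<delta>_def)
    finally show ?case .
  qed
qed

text \<open>A set that crosses no block boundary of a level lies in one of its blocks, where the
  blow-up is constant. This turns the tie condition of the lexicographic order into a condition on
  windows that can be counted.\<close>

lemma ex_level_perm:
  "\<exists>\<tau>. is_perm \<tau> \<and> length \<tau> = n \<and> (\<forall>I l. I \<subseteq> {0..<n} \<longrightarrow> l \<le> Suc L \<longrightarrow>
     inj_on (blow (block l n) (\<sigma> l)) I \<longrightarrow> I \<notin> (\<Union>s\<in>{l<..Suc L}. crossing (block s n)) \<longrightarrow>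
     pat_at \<tau> I = pat (blow (block l n) (\<sigma> l)) I)"
proof -
  have "inj (blow (block 0 n) (\<sigma> 0))"
    unfolding block_0 using \<sigma>_perm[of 0] w_pos[of 0] by (intro inj_blow_1) auto
  then obtain \<tau> where \<tau>: "is_perm \<tau>" "length \<tau> = n"
    "\<And>I l. I \<subseteq> {0..<n} \<Longrightarrow> l \<le> Suc L \<Longrightarrow> inj_on (blow (block l n) (\<sigma> l)) I \<Longrightarrow>
       (\<And>s i j. l < s \<Longrightarrow> s \<le> Suc L \<Longrightarrow> i \<in> I \<Longrightarrow> j \<in> I \<Longrightarrow>
          blow (block s n) (\<sigma> s) i = blow (block s n) (\<sigma> s) j) \<Longrightarrow>
       pat_at \<tau> I = pat (blow (block l n) (\<sigma> l)) I"
    using lexicographic_perm_exists[of "\<lambda>l. blow (block l n) (\<sigma> l)" n "Suc L"] by blast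
  have "pat_at \<tau> I = pat (blow (block l n) (\<sigma> l)) I"
    if I: "I \<subseteq> {0..<n}" "l \<le> Suc L" "inj_on (blow (block l n) (\<sigma> l)) I"
      "I \<notin> (\<Union>s\<in>{l<..Suc L}. crossing (block s n))" for I l
  proof (rule \<tau>(3)[OF I(1-3)])
    fix s i j assume s: "l < s" "s \<le> Suc L" "i \<in> I" "j \<in> I"
    then have "I \<notin> crossing (block s n)" using I(4) by auto
    then have "i div block s n = j div block s n"
      using s finite_subset[OF I(1)] by (intro same_block_if_not_crossing) auto
    then show "blow (block s n) (\<sigma> s) i = blow (block s n) (\<sigma> s) j" by (rule blow_eq_if_same_block)
  qed
  then show ?thesis using \<tau>(1,2) by blast
qed

text \<open>Fixed for each n before any pattern or level is considered, so that the asymptotic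
  statements for different levels and patterns concern the same permutations.\<close>

definition level_perm :: "nat \<Rightarrow> nat list" where
  "level_perm n = (SOME \<tau>. is_perm \<tau> \<and> length \<tau> = n \<and> (\<forall>I l. I \<subseteq> {0..<n} \<longrightarrow> l \<le> Suc L \<longrightarrow>
     inj_on (blow (block l n) (\<sigma> l)) I \<longrightarrow> I \<notin> (\<Union>s\<in>{l<..Suc L}. crossing (block s n)) \<longrightarrow>
     pat_at \<tau> I = pat (blow (block l n) (\<sigma> l)) I))"

lemma level_perm:
  shows "is_perm (level_perm n)" "length (level_perm n) = n"
    and "I \<subseteq> {0..<n} \<Longrightarrow> l \<le> Suc L \<Longrightarrow>
     inj_on (blow (block l n) (\<sigma> l)) I \<Longrightarrow> I \<notin> (\<Union>s\<in>{l<..Suc L}. crossing (block s n)) \<Longrightarrow>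
     pat_at (level_perm n) I = pat (blow (block l n) (\<sigma> l)) I"
  using someI_ex[OF ex_level_perm[of n]] unfolding level_perm_def by blast+

text \<open>Common form of three regimes. With N the length of \<open>\<sigma> l\<close>, the triple
  (m, v, q) is (k, k, n div N) for local density, the floor of F l n with \<open>w l\<close> and n
  div (N b) for a scale, and (n, N, 1) for global density. Unlifted and crossing windows cost
  \<epsilon> each; the bound of \<open>m\<close> by a multiple of \<open>F l\<close> makes crossings
  rare.\<close>

lemma level_perm_density:
  fixes m q :: "nat \<Rightarrow> nat"
  assumes l: "l \<le> Suc L" and k: "1 \<le> length \<pi>" and \<epsilon>: "\<epsilon> > 0"
    and m: "eventually (\<lambda>n. length \<pi> \<le> m n \<and> m n \<le> n \<and> real (m n) \<le> c * F l n) sequentially"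
    and fit: "eventually (\<lambda>n. v * block l n \<le> m n \<and> q n * length (\<sigma> l) * block l n \<le> n) sequentially"
    and most: "eventually (\<lambda>n. (1 - \<epsilon>) * real (card (windows (real (m n)) (length \<pi>) n)) \<le>
      real (q n * card (windows (real v) (length \<pi>) (length (\<sigma> l))) * block l n ^ length \<pi>)) sequentially"
  shows "eventually (\<lambda>n. \<bar>rho (real (m n)) \<pi> (level_perm n) - rho (real v) \<pi> (\<sigma> l)\<bar> \<le> 2 * \<epsilon>) sequentially"
proof -
  have "eventually (\<lambda>n. 1 \<le> m n \<and> real (m n) \<le> c * F l n) sequentially"
    using m by eventually_elim (use k in auto)
  from few_windows_crossing[OF l k \<epsilon> this] m fit most show ?thesis
  proof eventually_elim
    case (elim n)
    let ?k = "length \<pi>"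
    have "0 < (n - m n + 1) * ((m n - 1) choose (?k - 1))"
      using elim(2) k by (simp add: zero_less_binomial_iff diff_le_mono)
    also have "\<dots> \<le> card (windows (real (m n)) ?k n)"
      using elim(2) k by (intro card_windows_ge) auto
    finally have W: "card (windows (real (m n)) ?k n) > 0" .
    have agree: "pat_at (level_perm n) I = pat (blow (block l n) (\<sigma> l)) I"
      if "I \<in> windows (real (m n)) ?k n" "I \<notin> (\<Union>s\<in>{l<..Suc L}. crossing (block s n))"
        "inj_on (blow (block l n) (\<sigma> l)) I" for I
      using that by (intro level_perm(3)[OF _ l]) (simp_all add: windows_def)
    show ?case
      by (rule rho_blow_approx[OF \<sigma>_perm[OF l] k, where X = "\<Union>s\<in>{l<..Suc L}. crossing (block s n)"
            and b = "block l n" and q = "q n"])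
        (use elim W agree in \<open>simp_all add: level_perm(2)\<close>)
  qed
qed

lemma level_perm_local:
  assumes k: "1 \<le> length \<pi>" "length \<pi> \<le> length (\<sigma> 0)" and \<epsilon>: "\<epsilon> > 0" "\<epsilon> \<le> 1"
    and good: "1 - \<epsilon> < 1 - real (length \<pi>) / real (length (\<sigma> 0))"
  shows "eventually (\<lambda>n. \<bar>local_density \<pi> (level_perm n) - local_density \<pi> (\<sigma> 0)\<bar> \<le> 2 * \<epsilon>) sequentially"
  unfolding local_density_def
\<comment> \<open>Since F 0 n = 1, the constant \<open>c\<close> has to carry the whole width
  \<open>length \<pi>\<close>.\<close>
proof (rule level_perm_density[where c = "real (length \<pi>)" and q = "\<lambda>n. n div length (\<sigma> 0)"])
  show "eventually (\<lambda>n. length \<pi> \<le> length \<pi> \<and> length \<pi> \<le> n \<and> real (length \<pi>) \<le> real (length \<pi>) * F 0 n) sequentially"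
    using eventually_ge_at_top[of "length \<pi>"] by eventually_elim (simp add: F_0)
  show "eventually (\<lambda>n. (1 - \<epsilon>) * real (card (windows (real (length \<pi>)) (length \<pi>) n)) \<le>
      real (n div length (\<sigma> 0) * card (windows (real (length \<pi>)) (length \<pi>) (length (\<sigma> 0))) * block 0 n ^ length \<pi>))
      sequentially"
    unfolding block_0 by (rule most_windows_local[OF k \<epsilon>(2) good])
qed (use k \<epsilon> in \<open>auto simp: block_0\<close>)

lemma level_perm_global:
  assumes k: "1 \<le> length \<pi>" "length \<pi> \<le> length (\<sigma> (Suc L))" and \<epsilon>: "\<epsilon> > 0" "\<epsilon> \<le> 1"
    and good: "1 - \<epsilon> < (1 - real (length \<pi>) / real (length (\<sigma> (Suc L)))) ^ length \<pi>"
  shows "eventually (\<lambda>n. \<bar>global_density \<pi> (level_perm n) - global_density \<pi> (\<sigma> (Suc L))\<bar> \<le> 2 * \<epsilon>) sequentially"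
  unfolding global_density_def level_perm(2)
proof (rule level_perm_density[where c = 1 and q = "\<lambda>_. 1"])
  show "eventually (\<lambda>n. length \<pi> \<le> n \<and> n \<le> n \<and> real n \<le> 1 * F (Suc L) n) sequentially"
    using eventually_ge_at_top[of "length \<pi>"] by eventually_elim (simp add: F_top)
  show "eventually (\<lambda>n. (1 - \<epsilon>) * real (card (windows (real n) (length \<pi>) n)) \<le>
      real (1 * card (windows (real (length (\<sigma> (Suc L)))) (length \<pi>) (length (\<sigma> (Suc L)))) * block (Suc L) n ^ length \<pi>))
      sequentially"
    unfolding block_top by (rule most_windows_global[OF k \<epsilon>(2) good])
qed (use k \<epsilon> in \<open>auto simp: block_top\<close>)

lemma level_perm_scale:
  assumes l: "1 \<le> l" "l \<le> L" and k: "1 \<le> length \<pi>" "length \<pi> \<le> w l" and \<epsilon>: "\<epsilon> > 0" "\<epsilon> \<le> 1"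
    and good: "1 - \<epsilon> < (1 - real (w l) / real (length (\<sigma> l))) *
      ((real (w l) - real (length \<pi>)) / (real (w l) + 1)) ^ (length \<pi> - 1)"
  shows "eventually (\<lambda>n. \<bar>rho (F l n) \<pi> (level_perm n) - rho (real (w l)) \<pi> (\<sigma> l)\<bar> \<le> 2 * \<epsilon>) sequentially"
proof -
  have w: "w l \<le> length (\<sigma> l)" using w_pos[of l] l by auto
  have Ftop: "filterlim (F l) at_top sequentially" using l by (intro F_at_top) auto
  have "eventually (\<lambda>n. \<bar>rho (real (nat \<lfloor>F l n\<rfloor>)) \<pi> (level_perm n) - rho (real (w l)) \<pi> (\<sigma> l)\<bar> \<le> 2 * \<epsilon>) sequentially"
  proof (rule level_perm_density[where c = 1 and q = "\<lambda>n. n div (length (\<sigma> l) * block l n)"])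
    have "eventually (\<lambda>n. real (length \<pi>) \<le> F l n) sequentially"
      using Ftop by (simp add: filterlim_at_top)
    then show "eventually (\<lambda>n. length \<pi> \<le> nat \<lfloor>F l n\<rfloor> \<and> nat \<lfloor>F l n\<rfloor> \<le> n \<and> real (nat \<lfloor>F l n\<rfloor>) \<le> 1 * F l n) sequentially"
      using eventually_ge_at_top[of 1]
    proof eventually_elim
      case (elim n)
      have "0 < F l n" "F l n \<le> real n" using F_bounds[of l n] l elim by auto
      then show ?case using elim(1) le_nat_floor[of "length \<pi>" "F l n"] by linarith
    qed
    have "w l * block l n \<le> nat \<lfloor>F l n\<rfloor>" if "n \<ge> 1" for n
    proof -
      have F: "0 < F l n" using F_bounds[of l n] l that by auto
      have "real (block l n) \<le> F l n / real (w l)" unfolding block_def using F by simp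
      then have "real (w l * block l n) \<le> F l n" using k by (simp add: field_simps)
      then show ?thesis by (rule le_nat_floor)
    qed
    moreover have "n div (N * b) * N * b \<le> n" for n N b :: nat
      using div_times_less_eq_dividend[of n "N * b"] by (simp add: mult.assoc)
    ultimately show "eventually (\<lambda>n. w l * block l n \<le> nat \<lfloor>F l n\<rfloor> \<and>
        n div (length (\<sigma> l) * block l n) * length (\<sigma> l) * block l n \<le> n) sequentially"
      by (intro eventually_mono[OF eventually_ge_at_top[of 1]] conjI)
    show "eventually (\<lambda>n. (1 - \<epsilon>) * real (card (windows (real (nat \<lfloor>F l n\<rfloor>)) (length \<pi>) n)) \<le>
      real (n div (length (\<sigma> l) * block l n) * card (windows (real (w l)) (length \<pi>) (length (\<sigma> l))) * block l n ^ length \<pi>))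
      sequentially"
      unfolding block_def using F_scaling[OF l] k w \<epsilon>(2) good
      by (intro most_windows_scale) (auto simp: scaling_function_def)
  qed (use l k \<epsilon> in auto)
  then show ?thesis using eventually_ge_at_top[of 1]
  proof eventually_elim
    case (elim n)
    then show ?case using rho_floor[of "F l n"] F_bounds[of l n] l by simp
  qed
qed

end

subsection \<open>Approximation of the limit objects\<close>

lemma tendsto_const_over_length:
  assumes "perm_sequence \<sigma>"
  shows "(\<lambda>j. c / real (length (\<sigma> j))) \<longlonglongrightarrow> 0"
  using assms unfolding perm_sequence_def
  by (intro tendsto_divide_0[OF tendsto_const] filterlim_at_top_imp_at_infinity
      filterlim_compose[OF filterlim_real_sequentially]) auto

text \<open>The last condition is the proportion of lifted windows demanded by
  \<open>level_perm_local\<close>; it holds far along the defining sequence, where lengths are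
  large.\<close>

lemma local_limit_approx:
  assumes \<Lambda>: "perm_local_limit \<Lambda>" and P: "finite P" "P \<subseteq> PermS" and \<epsilon>: "\<epsilon> > 0"
  obtains \<sigma> where "is_perm \<sigma>" "1 \<le> length \<sigma>"
    "\<And>\<pi>. \<pi> \<in> P \<Longrightarrow> length \<pi> \<le> length \<sigma> \<and> \<bar>local_density \<pi> \<sigma> - \<Lambda> \<pi>\<bar> < \<epsilon> \<and>
       1 - \<epsilon> < 1 - real (length \<pi>) / real (length \<sigma>)"
proof -
  obtain s where s: "perm_sequence s" "converges_locally s \<Lambda>"
    using \<Lambda> by (auto simp: perm_local_limit_def)
  have top: "filterlim (\<lambda>j. length (s j)) at_top sequentially" using s by (simp add: perm_sequence_def)
  have "eventually (\<lambda>j. length \<pi> \<le> length (s j) \<and> \<bar>local_density \<pi> (s j) - \<Lambda> \<pi>\<bar> < \<epsilon> \<and>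
       1 - \<epsilon> < 1 - real (length \<pi>) / real (length (s j))) sequentially" if "\<pi> \<in> P" for \<pi>
  proof (intro eventually_conj)
    show "eventually (\<lambda>j. length \<pi> \<le> length (s j)) sequentially" using top by (simp add: filterlim_at_top)
    have "(\<lambda>j. local_density \<pi> (s j)) \<longlonglongrightarrow> \<Lambda> \<pi>" using s P that by (auto simp: converges_locally_def)
    then show "eventually (\<lambda>j. \<bar>local_density \<pi> (s j) - \<Lambda> \<pi>\<bar> < \<epsilon>) sequentially"
      using \<epsilon> tendstoD by (fastforce simp: dist_real_def)
    show "eventually (\<lambda>j. 1 - \<epsilon> < 1 - real (length \<pi>) / real (length (s j))) sequentially"
      using order_tendstoD(2)[OF tendsto_const_over_length[OF s(1)] \<epsilon>, of "real (length \<pi>)"]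
      by eventually_elim simp
  qed
  then have "eventually (\<lambda>j. \<forall>\<pi>\<in>P. length \<pi> \<le> length (s j) \<and> \<bar>local_density \<pi> (s j) - \<Lambda> \<pi>\<bar> < \<epsilon> \<and>
       1 - \<epsilon> < 1 - real (length \<pi>) / real (length (s j))) sequentially"
    using P by (intro eventually_ball_finite) auto
  moreover have "eventually (\<lambda>j. 1 \<le> length (s j)) sequentially" using top by (simp add: filterlim_at_top)
  ultimately have "eventually (\<lambda>j. 1 \<le> length (s j) \<and> (\<forall>\<pi>\<in>P. length \<pi> \<le> length (s j) \<and>
      \<bar>local_density \<pi> (s j) - \<Lambda> \<pi>\<bar> < \<epsilon> \<and> 1 - \<epsilon> < 1 - real (length \<pi>) / real (length (s j)))) sequentially"
    by eventually_elim auto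
  then obtain j where "1 \<le> length (s j)" "\<forall>\<pi>\<in>P. length \<pi> \<le> length (s j) \<and>
      \<bar>local_density \<pi> (s j) - \<Lambda> \<pi>\<bar> < \<epsilon> \<and> 1 - \<epsilon> < 1 - real (length \<pi>) / real (length (s j))"
    using eventually_happens'[OF sequentially_bot] by blast
  moreover have "is_perm (s j)" using s by (simp add: perm_sequence_def)
  ultimately show ?thesis using that by blast
qed

text \<open>Sampling yields a good permutation of every sufficiently large length, so the length can
  also be taken large enough for the proportion demanded by
  \<open>level_perm_global\<close>.\<close>

lemma permuton_approx:
  assumes \<Gamma>: "permuton \<Gamma>" and P: "finite P" "P \<subseteq> PermS" and \<epsilon>: "\<epsilon> > 0"
  obtains \<sigma> where "is_perm \<sigma>" "1 \<le> length \<sigma>"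
    "\<And>\<pi>. \<pi> \<in> P \<Longrightarrow> length \<pi> \<le> length \<sigma> \<and> \<bar>global_density \<pi> \<sigma> - permuton_density \<pi> \<Gamma>\<bar> < \<epsilon> \<and>
       1 - \<epsilon> < (1 - real (length \<pi>) / real (length \<sigma>)) ^ length \<pi>"
proof -
  have "eventually (\<lambda>N. length \<pi> \<le> N \<and> 1 - \<epsilon> < (1 - real (length \<pi>) / real N) ^ length \<pi>) sequentially" for \<pi> :: "nat list"
  proof (rule eventually_conj[OF eventually_ge_at_top])
    have "(\<lambda>N. (1 - real (length \<pi>) * (1 / real N)) ^ length \<pi>) \<longlonglongrightarrow> (1 - real (length \<pi>) * 0) ^ length \<pi>"
      by (intro tendsto_intros lim_1_over_n)
    then have "(\<lambda>N. (1 - real (length \<pi>) / real N) ^ length \<pi>) \<longlonglongrightarrow> 1" by simp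
    then show "eventually (\<lambda>N. 1 - \<epsilon> < (1 - real (length \<pi>) / real N) ^ length \<pi>) sequentially"
      using \<epsilon> by (intro order_tendstoD) auto
  qed
  then have "eventually (\<lambda>N. \<forall>\<pi>\<in>P. length \<pi> \<le> N \<and> 1 - \<epsilon> < (1 - real (length \<pi>) / real N) ^ length \<pi>) sequentially"
    using P by (intro eventually_ball_finite) auto
  with permuton_approx_by_perm[OF \<Gamma> P \<epsilon>] eventually_ge_at_top[of 1]
  have "eventually (\<lambda>N. 1 \<le> N \<and> (\<forall>\<pi>\<in>P. length \<pi> \<le> N \<and> 1 - \<epsilon> < (1 - real (length \<pi>) / real N) ^ length \<pi>) \<and>
    (\<exists>\<sigma>. is_perm \<sigma> \<and> length \<sigma> = N \<and>
    (\<forall>\<pi>\<in>P. \<bar>global_density \<pi> \<sigma> - permuton_density \<pi> \<Gamma>\<bar> < \<epsilon>))) sequentially"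
    by eventually_elim auto
  then obtain N where "1 \<le> N" "\<forall>\<pi>\<in>P. length \<pi> \<le> N \<and> 1 - \<epsilon> < (1 - real (length \<pi>) / real N) ^ length \<pi>"
    "\<exists>\<sigma>. is_perm \<sigma> \<and> length \<sigma> = N \<and> (\<forall>\<pi>\<in>P. \<bar>global_density \<pi> \<sigma> - permuton_density \<pi> \<Gamma>\<bar> < \<epsilon>)"
    using eventually_happens'[OF sequentially_bot] by blast
  then show ?thesis using that by blast
qed

text \<open>The scaling function \<open>f\<close> of the defining sequence disappears here. A single
  far member, with \<open>w\<close> the floor of \<open>f\<close> at its length, keeps just three
  facts: the densities are close to \<Xi>, \<open>w\<close> is large, and \<open>w\<close> is small
  compared with the length.\<close>

lemma scale_limit_approx:
  assumes \<Xi>: "scale_limit \<Xi>" and P: "finite P" "P \<subseteq> PermS" and \<epsilon>: "\<epsilon> > 0"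
  shows "\<exists>\<sigma> w. is_perm \<sigma> \<and> 1 \<le> w \<and> w \<le> length \<sigma> \<and>
    (\<forall>\<pi>\<in>P. length \<pi> \<le> w \<and> \<bar>rho (real w) \<pi> \<sigma> - \<Xi> \<pi>\<bar> < \<epsilon> \<and>
       1 - \<epsilon> < (1 - real w / real (length \<sigma>)) * ((real w - real (length \<pi>)) / (real w + 1)) ^ (length \<pi> - 1))"
proof -
  obtain f s where f: "scaling_function f" and s: "perm_sequence s" "converges_at_scale f s \<Xi>"
    using \<Xi> by (auto simp: scale_limit_def)
  define N where "N = (\<lambda>j. length (s j))"
  define w where "w j = nat \<lfloor>f (N j)\<rfloor>" for j
  have N: "filterlim N at_top sequentially" using s(1) by (simp add: perm_sequence_def N_def)
  have f_top: "filterlim (\<lambda>j. f (N j)) at_top sequentially"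
    using f filterlim_compose[OF _ N, of f at_top] by (simp add: scaling_function_def)
  have f_0: "(\<lambda>j. f (N j) / real (N j)) \<longlonglongrightarrow> 0"
    using f filterlim_compose[OF _ N, of "\<lambda>n. f n / real n"] by (simp add: scaling_function_def)
  have N1: "eventually (\<lambda>j. 1 \<le> N j) sequentially" using N by (simp add: filterlim_at_top)
  then have f_bounds: "eventually (\<lambda>j. 0 < f (N j) \<and> f (N j) \<le> real (N j)) sequentially"
    by eventually_elim (use f in \<open>auto simp: scaling_function_def\<close>)
  have w_top: "filterlim (\<lambda>j. real (w j)) at_top sequentially"
    unfolding filterlim_at_top
  proof
    fix Z :: real
    have "eventually (\<lambda>j. Z + 1 \<le> f (N j)) sequentially" using f_top by (simp add: filterlim_at_top)
    then show "eventually (\<lambda>j. Z \<le> real (w j)) sequentially"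
      by eventually_elim (unfold w_def, linarith)
  qed
  have w_0: "(\<lambda>j. real (w j) / real (N j)) \<longlonglongrightarrow> 0"
  proof (rule tendsto_sandwich[OF _ _ tendsto_const f_0])
    show "eventually (\<lambda>j. real (w j) / real (N j) \<le> f (N j) / real (N j)) sequentially"
      using f_bounds by eventually_elim (auto simp: w_def intro!: divide_right_mono)
  qed simp
  have "eventually (\<lambda>j. length \<pi> \<le> w j \<and> \<bar>rho (real (w j)) \<pi> (s j) - \<Xi> \<pi>\<bar> < \<epsilon> \<and>
       1 - \<epsilon> < (1 - real (w j) / real (N j)) * ((real (w j) - real (length \<pi>)) / (real (w j) + 1)) ^ (length \<pi> - 1))
       sequentially" if "\<pi> \<in> P" for \<pi>
  proof (intro eventually_conj)
    have "eventually (\<lambda>j. real (length \<pi>) \<le> real (w j)) sequentially" using w_top unfolding filterlim_at_top by blast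
    then show "eventually (\<lambda>j. length \<pi> \<le> w j) sequentially" by simp
    have "(\<lambda>j. rho (f (N j)) \<pi> (s j)) \<longlonglongrightarrow> \<Xi> \<pi>"
      using s P that by (auto simp: converges_at_scale_def N_def)
    then have "eventually (\<lambda>j. \<bar>rho (f (N j)) \<pi> (s j) - \<Xi> \<pi>\<bar> < \<epsilon>) sequentially"
      using \<epsilon> tendstoD by (fastforce simp: dist_real_def)
    then show "eventually (\<lambda>j. \<bar>rho (real (w j)) \<pi> (s j) - \<Xi> \<pi>\<bar> < \<epsilon>) sequentially"
      using f_bounds
    proof eventually_elim
      case (elim j)
      then show ?case using rho_floor[of "f (N j)" \<pi> "s j"] by (simp add: w_def)
    qed
    have "filterlim (\<lambda>j. real (w j) + 1) at_top sequentially"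
      using filterlim_tendsto_add_at_top[OF tendsto_const w_top, of 1] by (simp add: add.commute)
    then have "(\<lambda>j. (real (length \<pi>) + 1) / (real (w j) + 1)) \<longlonglongrightarrow> 0"
      by (intro tendsto_divide_0[OF tendsto_const] filterlim_at_top_imp_at_infinity)
    \<comment> \<open>(w - k) / (w + 1) is rewritten as 1 - (k + 1) / (w + 1), whose limit is
      1.\<close>
    then have "(\<lambda>j. 1 - (real (length \<pi>) + 1) / (real (w j) + 1)) \<longlonglongrightarrow> 1 - 0" by (intro tendsto_intros)
    moreover have "1 - (real (length \<pi>) + 1) / (real (w j) + 1) = (real (w j) - real (length \<pi>)) / (real (w j) + 1)" for j
    proof -
      have "real (w j) + 1 \<noteq> 0" by linarith
      then show ?thesis by (simp add: field_simps)
    qed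
    ultimately have "(\<lambda>j. (real (w j) - real (length \<pi>)) / (real (w j) + 1)) \<longlonglongrightarrow> 1" by simp
    then have "(\<lambda>j. (1 - real (w j) / real (N j)) *
        ((real (w j) - real (length \<pi>)) / (real (w j) + 1)) ^ (length \<pi> - 1)) \<longlonglongrightarrow> (1 - 0) * 1 ^ (length \<pi> - 1)"
      using w_0 by (intro tendsto_intros)
    then show "eventually (\<lambda>j. 1 - \<epsilon> < (1 - real (w j) / real (N j)) *
        ((real (w j) - real (length \<pi>)) / (real (w j) + 1)) ^ (length \<pi> - 1)) sequentially"
      using \<epsilon> by (intro order_tendstoD) auto
  qed
  then have "eventually (\<lambda>j. \<forall>\<pi>\<in>P. length \<pi> \<le> w j \<and> \<bar>rho (real (w j)) \<pi> (s j) - \<Xi> \<pi>\<bar> < \<epsilon> \<and>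
       1 - \<epsilon> < (1 - real (w j) / real (N j)) * ((real (w j) - real (length \<pi>)) / (real (w j) + 1)) ^ (length \<pi> - 1))
       sequentially"
    using P by (intro eventually_ball_finite) auto
  moreover have "eventually (\<lambda>j. 1 \<le> real (w j)) sequentially" using w_top unfolding filterlim_at_top by blast
  moreover have "eventually (\<lambda>j. w j \<le> N j) sequentially"
    using f_bounds by eventually_elim (unfold w_def, linarith)
  ultimately have "eventually (\<lambda>j. 1 \<le> w j \<and> w j \<le> N j \<and>
      (\<forall>\<pi>\<in>P. length \<pi> \<le> w j \<and> \<bar>rho (real (w j)) \<pi> (s j) - \<Xi> \<pi>\<bar> < \<epsilon> \<and>
       1 - \<epsilon> < (1 - real (w j) / real (N j)) * ((real (w j) - real (length \<pi>)) / (real (w j) + 1)) ^ (length \<pi> - 1)))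
       sequentially"
    by eventually_elim auto
  then obtain j where j: "1 \<le> w j \<and> w j \<le> N j \<and>
      (\<forall>\<pi>\<in>P. length \<pi> \<le> w j \<and> \<bar>rho (real (w j)) \<pi> (s j) - \<Xi> \<pi>\<bar> < \<epsilon> \<and>
       1 - \<epsilon> < (1 - real (w j) / real (N j)) * ((real (w j) - real (length \<pi>)) / (real (w j) + 1)) ^ (length \<pi> - 1))"
    using eventually_happens'[OF sequentially_bot] by blast
  moreover have "is_perm (s j)" using s by (simp add: perm_sequence_def)
  ultimately show ?thesis unfolding N_def by (intro exI[of _ "s j"] exI[of _ "w j"]) simp
qed

section \<open>Finitely many scales at once, and the diagonal sequence\<close>

lemma order_by_domination:
  fixes fs :: "nat \<Rightarrow> nat \<Rightarrow> real"
  assumes scaling: "\<And>t. scaling_function (fs t)"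
    and total: "\<And>s t. s \<noteq> t \<Longrightarrow> dominated (fs s) (fs t) \<or> dominated (fs t) (fs s)"
  obtains r where "bij_betw r {0..<K} {0..<K}"
    "\<And>s t. s < K \<Longrightarrow> t < K \<Longrightarrow> r s < r t \<Longrightarrow> dominated (fs s) (fs t)"
proof -
  \<comment> \<open>Domination implies strict inequality of the values at every large n, so for
    finitely many functions the values at one suitable n sort them all.\<close>
  have "eventually (\<lambda>n. dominated (fs s) (fs t) \<longrightarrow> fs s n < fs t n) sequentially" for s t
  proof (cases "dominated (fs s) (fs t)")
    case True
    then have "eventually (\<lambda>n. fs s n / fs t n < 1) sequentially"
      unfolding dominated_def by (intro order_tendstoD) auto
    then show ?thesis using eventually_ge_at_top[of 1]
    proof eventually_elim
      case (elim n)
      then have "0 < fs t n" using scaling[of t] by (auto simp: scaling_function_def)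
      then show ?case using elim by (simp add: divide_less_eq)
    qed
  qed simp
  then have "eventually (\<lambda>n. \<forall>s\<in>{0..<K}. \<forall>t\<in>{0..<K}. dominated (fs s) (fs t) \<longrightarrow> fs s n < fs t n) sequentially"
    by (intro eventually_ball_finite ballI) auto
  then obtain n where n: "\<forall>s\<in>{0..<K}. \<forall>t\<in>{0..<K}. dominated (fs s) (fs t) \<longrightarrow> fs s n < fs t n"
    using eventually_happens'[OF sequentially_bot] by blast
  have "inj_on (\<lambda>t. fs t n) {0..<K}"
  proof (rule inj_onI, rule ccontr)
    fix s t assume h: "s \<in> {0..<K}" "t \<in> {0..<K}" "fs s n = fs t n" "s \<noteq> t"
    then have "fs s n < fs t n \<or> fs t n < fs s n" using total[OF h(4)] n by blast
    then show False using h by simp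
  qed
  then obtain r where r: "bij_betw r {0..<K} {0..<K}"
    "\<And>s t. s < K \<Longrightarrow> t < K \<Longrightarrow> r s < r t \<longleftrightarrow> fs s n < fs t n"
    using ex_rank_function[of "\<lambda>t. fs t n" K] by blast
  have "dominated (fs s) (fs t)" if "s < K" "t < K" "r s < r t" for s t
  proof -
    have lt: "fs s n < fs t n" and ne: "s \<noteq> t" using r(2) that by auto
    have "\<not> dominated (fs t) (fs s)"
    proof
      assume "dominated (fs t) (fs s)"
      then have "fs t n < fs s n" using n that by simp
      then show False using lt by simp
    qed
    then show ?thesis using total[OF ne] by blast
  qed
  then show ?thesis using that r(1) by blast
qed

text \<open>The tolerance 3 \<epsilon> consists of \<epsilon> for replacing a limit object by a
  fixed permutation and 2 \<epsilon> for realising that permutation as a level. Each of the finitely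
  many requirements holds for all large n, so one n meets them all.\<close>

lemma simultaneous_approx:
  fixes fs :: "nat \<Rightarrow> nat \<Rightarrow> real"
  assumes scaling: "\<And>t. scaling_function (fs t)"
    and total: "\<And>s t. s \<noteq> t \<Longrightarrow> dominated (fs s) (fs t) \<or> dominated (fs t) (fs s)"
    and scale_lim: "\<And>t. scale_limit (\<Xi> t)"
    and permuton: "permuton \<Gamma>"
    and local_lim: "perm_local_limit \<Lambda>"
    and \<epsilon>: "0 < \<epsilon>" "\<epsilon> \<le> 1" and P: "finite P" "P \<subseteq> PermS"
  shows "\<exists>\<tau>. is_perm \<tau> \<and> K \<le> length \<tau> \<and> (\<forall>\<pi>\<in>P.
    (\<forall>t<K. \<bar>rho (fs t (length \<tau>)) \<pi> \<tau> - \<Xi> t \<pi>\<bar> \<le> 3 * \<epsilon>) \<and>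
    \<bar>global_density \<pi> \<tau> - permuton_density \<pi> \<Gamma>\<bar> \<le> 3 * \<epsilon> \<and> \<bar>local_density \<pi> \<tau> - \<Lambda> \<pi>\<bar> \<le> 3 * \<epsilon>)"
proof -
  obtain r where r: "bij_betw r {0..<K} {0..<K}"
    "\<And>s t. s < K \<Longrightarrow> t < K \<Longrightarrow> r s < r t \<Longrightarrow> dominated (fs s) (fs t)"
    by (rule order_by_domination[of fs K, OF scaling total], assumption, rule that)
  define u where "u = inv_into {0..<K} r"
  have u: "u i < K" "r (u i) = i" if "i < K" for i
  proof -
    have "i \<in> r ` {0..<K}" using r(1) that by (simp add: bij_betw_def)
    then show "u i < K" "r (u i) = i"
      using inv_into_into[of i r "{0..<K}"] f_inv_into_f[of i r "{0..<K}"] by (simp_all add: u_def)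
  qed
  have ur: "u (r t) = t" "r t < K" if "t < K" for t
    using r(1) that bij_betwE[OF r(1)] by (auto simp: u_def bij_betw_def)
  obtain \<sigma>\<Lambda> where \<sigma>\<Lambda>: "is_perm \<sigma>\<Lambda>" "1 \<le> length \<sigma>\<Lambda>"
    "\<And>\<pi>. \<pi> \<in> P \<Longrightarrow> length \<pi> \<le> length \<sigma>\<Lambda> \<and> \<bar>local_density \<pi> \<sigma>\<Lambda> - \<Lambda> \<pi>\<bar> < \<epsilon> \<and>
       1 - \<epsilon> < 1 - real (length \<pi>) / real (length \<sigma>\<Lambda>)"
    by (rule local_limit_approx[OF local_lim P \<epsilon>(1)]) (rule that)
  obtain \<sigma>\<Gamma> where \<sigma>\<Gamma>: "is_perm \<sigma>\<Gamma>" "1 \<le> length \<sigma>\<Gamma>"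
    "\<And>\<pi>. \<pi> \<in> P \<Longrightarrow> length \<pi> \<le> length \<sigma>\<Gamma> \<and> \<bar>global_density \<pi> \<sigma>\<Gamma> - permuton_density \<pi> \<Gamma>\<bar> < \<epsilon> \<and>
       1 - \<epsilon> < (1 - real (length \<pi>) / real (length \<sigma>\<Gamma>)) ^ length \<pi>"
    by (rule permuton_approx[OF permuton P \<epsilon>(1)]) (rule that)
  define good where "good t \<sigma> w \<longleftrightarrow> is_perm \<sigma> \<and> 1 \<le> w \<and> w \<le> length \<sigma> \<and>
    (\<forall>\<pi>\<in>P. length \<pi> \<le> w \<and> \<bar>rho (real w) \<pi> \<sigma> - \<Xi> t \<pi>\<bar> < \<epsilon> \<and>
       1 - \<epsilon> < (1 - real w / real (length \<sigma>)) * ((real w - real (length \<pi>)) / (real w + 1)) ^ (length \<pi> - 1))"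
    for t \<sigma> and w :: nat
  have "\<forall>t. \<exists>\<sigma> w. good t \<sigma> w"
    unfolding good_def using scale_limit_approx[OF scale_lim P \<epsilon>(1)] by (intro allI)
  then obtain \<sigma>\<Xi> v where good: "\<And>t. good t (\<sigma>\<Xi> t) (v t)" by metis
  have \<sigma>\<Xi>: "\<And>t. is_perm (\<sigma>\<Xi> t)" "\<And>t. 1 \<le> v t" "\<And>t. v t \<le> length (\<sigma>\<Xi> t)"
    "\<And>t \<pi>. \<pi> \<in> P \<Longrightarrow> length \<pi> \<le> v t \<and> \<bar>rho (real (v t)) \<pi> (\<sigma>\<Xi> t) - \<Xi> t \<pi>\<bar> < \<epsilon> \<and>
       1 - \<epsilon> < (1 - real (v t) / real (length (\<sigma>\<Xi> t))) *
         ((real (v t) - real (length \<pi>)) / (real (v t) + 1)) ^ (length \<pi> - 1)"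
    using good unfolding good_def by blast+
  \<comment> \<open>Level \<open>Suc i\<close> carries the scaling function of rank i, so indices
    increase with domination, \<open>0\<close> stays free for \<Lambda> and \<open>Suc K\<close> for
    \<Gamma>.\<close>
  define F where "F l = (if l = 0 then (\<lambda>_. 1) else if l \<le> K then fs (u (l - 1)) else real)" for l
  define \<sigma> where "\<sigma> l = (if l = 0 then \<sigma>\<Lambda> else if l \<le> K then \<sigma>\<Xi> (u (l - 1)) else \<sigma>\<Gamma>)" for l
  define w where "w l = (if l = 0 then 1 else if l \<le> K then v (u (l - 1)) else length \<sigma>\<Gamma>)" for l
  interpret level_system K F \<sigma> w
  proof
    fix l s assume "1 \<le> l" "l < s" "s \<le> K"
    then show "dominated (F l) (F s)"
      unfolding F_def using u[of "l - 1"] u[of "s - 1"] by (auto intro!: r(2))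
  qed (use scaling \<sigma>\<Lambda> \<sigma>\<Gamma> \<sigma>\<Xi> in \<open>auto simp: F_def \<sigma>_def w_def\<close>)
  have len: "1 \<le> length \<pi>" if "\<pi> \<in> P" for \<pi> using P that by (auto simp: PermS_def)
  have "eventually (\<lambda>n. \<bar>rho (fs t n) \<pi> (level_perm n) - \<Xi> t \<pi>\<bar> \<le> 3 * \<epsilon>) sequentially"
    if \<pi>: "\<pi> \<in> P" and t: "t < K" for \<pi> t
  proof -
    have l: "1 \<le> Suc (r t)" "Suc (r t) \<le> K" using ur[OF t] by auto
    have eqs: "F (Suc (r t)) = fs t" "\<sigma> (Suc (r t)) = \<sigma>\<Xi> t" "w (Suc (r t)) = v t"
      using ur[OF t] by (simp_all add: F_def \<sigma>_def w_def)
    have "eventually (\<lambda>n. \<bar>rho (fs t n) \<pi> (level_perm n) - rho (real (v t)) \<pi> (\<sigma>\<Xi> t)\<bar> \<le> 2 * \<epsilon>) sequentially"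
      using level_perm_scale[OF l len[OF \<pi>], unfolded eqs] \<sigma>\<Xi>(4)[OF \<pi>, of t] \<epsilon> by blast
    then show ?thesis by eventually_elim (use \<sigma>\<Xi>(4)[OF \<pi>, of t] in linarith)
  qed
  moreover have "eventually (\<lambda>n. \<bar>global_density \<pi> (level_perm n) - permuton_density \<pi> \<Gamma>\<bar> \<le> 3 * \<epsilon>) sequentially"
    if \<pi>: "\<pi> \<in> P" for \<pi>
  proof -
    have eqs: "\<sigma> (Suc K) = \<sigma>\<Gamma>" by (simp add: \<sigma>_def)
    have "eventually (\<lambda>n. \<bar>global_density \<pi> (level_perm n) - global_density \<pi> \<sigma>\<Gamma>\<bar> \<le> 2 * \<epsilon>) sequentially"
      using level_perm_global[OF len[OF \<pi>], unfolded eqs] \<sigma>\<Gamma>(3)[OF \<pi>] \<epsilon> by blast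
    then show ?thesis by eventually_elim (use \<sigma>\<Gamma>(3)[OF \<pi>] in linarith)
  qed
  moreover have "eventually (\<lambda>n. \<bar>local_density \<pi> (level_perm n) - \<Lambda> \<pi>\<bar> \<le> 3 * \<epsilon>) sequentially"
    if \<pi>: "\<pi> \<in> P" for \<pi>
  proof -
    have eqs: "\<sigma> 0 = \<sigma>\<Lambda>" by (simp add: \<sigma>_def)
    have "eventually (\<lambda>n. \<bar>local_density \<pi> (level_perm n) - local_density \<pi> \<sigma>\<Lambda>\<bar> \<le> 2 * \<epsilon>) sequentially"
      using level_perm_local[OF len[OF \<pi>], unfolded eqs] \<sigma>\<Lambda>(3)[OF \<pi>] \<epsilon> by blast
    then show ?thesis by eventually_elim (use \<sigma>\<Lambda>(3)[OF \<pi>] in linarith)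
  qed
  ultimately have "eventually (\<lambda>n. \<forall>\<pi>\<in>P. (\<forall>t\<in>{..<K}. \<bar>rho (fs t n) \<pi> (level_perm n) - \<Xi> t \<pi>\<bar> \<le> 3 * \<epsilon>) \<and>
    \<bar>global_density \<pi> (level_perm n) - permuton_density \<pi> \<Gamma>\<bar> \<le> 3 * \<epsilon> \<and>
    \<bar>local_density \<pi> (level_perm n) - \<Lambda> \<pi>\<bar> \<le> 3 * \<epsilon>) sequentially"
    using P by (intro eventually_ball_finite ballI eventually_conj) auto
  then have "eventually (\<lambda>n. K \<le> n \<and> (\<forall>\<pi>\<in>P. (\<forall>t\<in>{..<K}. \<bar>rho (fs t n) \<pi> (level_perm n) - \<Xi> t \<pi>\<bar> \<le> 3 * \<epsilon>) \<and>
    \<bar>global_density \<pi> (level_perm n) - permuton_density \<pi> \<Gamma>\<bar> \<le> 3 * \<epsilon> \<and>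
    \<bar>local_density \<pi> (level_perm n) - \<Lambda> \<pi>\<bar> \<le> 3 * \<epsilon>)) sequentially"
    by (rule eventually_conj[OF eventually_ge_at_top])
  then obtain n where n: "K \<le> n" "\<forall>\<pi>\<in>P. (\<forall>t\<in>{..<K}. \<bar>rho (fs t n) \<pi> (level_perm n) - \<Xi> t \<pi>\<bar> \<le> 3 * \<epsilon>) \<and>
    \<bar>global_density \<pi> (level_perm n) - permuton_density \<pi> \<Gamma>\<bar> \<le> 3 * \<epsilon> \<and>
    \<bar>local_density \<pi> (level_perm n) - \<Lambda> \<pi>\<bar> \<le> 3 * \<epsilon>"
    using eventually_happens'[OF sequentially_bot] by blast
  then show ?thesis by (intro exI[of _ "level_perm n"]) (simp add: level_perm)
qed

lemma finite_PermS_le: "finite {\<pi> \<in> PermS. length \<pi> \<le> K}"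
proof (rule finite_subset)
  show "{\<pi> \<in> PermS. length \<pi> \<le> K} \<subseteq> {\<pi>. set \<pi> \<subseteq> {0..<K} \<and> length \<pi> \<le> K}"
    by (auto simp: PermS_def is_perm_def)
qed (simp add: finite_lists_length_le)

theorem mainTheorem9:
  fixes fs :: "nat \<Rightarrow> nat \<Rightarrow> real"
    and \<Xi> :: "nat \<Rightarrow> nat list \<Rightarrow> real"
    and \<Gamma> :: "(real \<times> real) measure"
    and \<Lambda> :: "nat list \<Rightarrow> real"
  assumes inj: "inj fs"
    and scaling: "\<And>t. scaling_function (fs t)"
    and total: "\<And>s t. s \<noteq> t \<Longrightarrow> dominated (fs s) (fs t) \<or> dominated (fs t) (fs s)"
    and scale_lim: "\<And>t. scale_limit (\<Xi> t)"
    and permuton: "permuton \<Gamma>"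
    and local_lim: "perm_local_limit \<Lambda>"
  shows "\<exists>\<tau>. perm_sequence \<tau> \<and>
           (\<forall>t. converges_at_scale (fs t) \<tau> (\<Xi> t)) \<and>
           converges_globally \<tau> \<Gamma> \<and>
           converges_locally \<tau> \<Lambda>"
proof -
  \<comment> \<open>Stage K treats the scales t < K and the patterns of length at most K with
    tolerance 3 / (K + 1). A fixed pattern and scale are therefore controlled from K = max (length
    \<pi>) (t + 1) on.\<close>
  define e where "e K = 1 / real (Suc K)" for K
  have e: "0 < e K" "e K \<le> 1" for K by (simp_all add: e_def)
  have approx: "\<forall>K. \<exists>\<tau>. is_perm \<tau> \<and> K \<le> length \<tau> \<and> (\<forall>\<pi>\<in>{\<pi> \<in> PermS. length \<pi> \<le> K}.
    (\<forall>t<K. \<bar>rho (fs t (length \<tau>)) \<pi> \<tau> - \<Xi> t \<pi>\<bar> \<le> 3 * e K) \<and>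
    \<bar>global_density \<pi> \<tau> - permuton_density \<pi> \<Gamma>\<bar> \<le> 3 * e K \<and> \<bar>local_density \<pi> \<tau> - \<Lambda> \<pi>\<bar> \<le> 3 * e K)"
    using scaling total scale_lim permuton local_lim e finite_PermS_le
    by (intro allI simultaneous_approx) auto
  obtain \<tau> where \<tau>: "\<And>K. is_perm (\<tau> K)" "\<And>K. K \<le> length (\<tau> K)"
    "\<And>K \<pi> t. \<pi> \<in> PermS \<Longrightarrow> length \<pi> \<le> K \<Longrightarrow> t < K \<Longrightarrow>
      \<bar>rho (fs t (length (\<tau> K))) \<pi> (\<tau> K) - \<Xi> t \<pi>\<bar> \<le> 3 * e K"
    "\<And>K \<pi>. \<pi> \<in> PermS \<Longrightarrow> length \<pi> \<le> K \<Longrightarrow> \<bar>global_density \<pi> (\<tau> K) - permuton_density \<pi> \<Gamma>\<bar> \<le> 3 * e K"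
    "\<And>K \<pi>. \<pi> \<in> PermS \<Longrightarrow> length \<pi> \<le> K \<Longrightarrow> \<bar>local_density \<pi> (\<tau> K) - \<Lambda> \<pi>\<bar> \<le> 3 * e K"
  proof -
    obtain \<tau> where "\<forall>K. is_perm (\<tau> K) \<and> K \<le> length (\<tau> K) \<and> (\<forall>\<pi>\<in>{\<pi> \<in> PermS. length \<pi> \<le> K}.
      (\<forall>t<K. \<bar>rho (fs t (length (\<tau> K))) \<pi> (\<tau> K) - \<Xi> t \<pi>\<bar> \<le> 3 * e K) \<and>
      \<bar>global_density \<pi> (\<tau> K) - permuton_density \<pi> \<Gamma>\<bar> \<le> 3 * e K \<and>
      \<bar>local_density \<pi> (\<tau> K) - \<Lambda> \<pi>\<bar> \<le> 3 * e K)"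
      using choice[OF approx] by (elim exE)
    then show ?thesis by (intro that[of \<tau>]) simp_all
  qed
  have e_lim: "(\<lambda>K. 3 * e K) \<longlonglongrightarrow> 0"
    using tendsto_mult[OF tendsto_const[of 3] LIMSEQ_inverse_real_of_nat] by (simp add: e_def inverse_eq_divide)
  have lim: "x \<longlonglongrightarrow> a" if "\<And>K. K \<ge> K0 \<Longrightarrow> \<bar>x K - a\<bar> \<le> 3 * e K" for x :: "nat \<Rightarrow> real" and a K0
  proof -
    have "(\<lambda>K. x K - a) \<longlonglongrightarrow> 0"
      by (rule Lim_null_comparison[OF _ e_lim]) (use that in \<open>auto simp: eventually_sequentially\<close>)
    then show ?thesis by (simp add: LIM_zero_iff)
  qed
  have "perm_sequence \<tau>"
    unfolding perm_sequence_def
    using \<tau>(1) filterlim_at_top_mono[OF filterlim_ident, of "\<lambda>K. length (\<tau> K)"] \<tau>(2) by simp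
  moreover have "converges_at_scale (fs t) \<tau> (\<Xi> t)" for t
    unfolding converges_at_scale_def
  proof
    fix \<pi> assume "\<pi> \<in> PermS"
    then show "(\<lambda>j. rho (fs t (length (\<tau> j))) \<pi> (\<tau> j)) \<longlonglongrightarrow> \<Xi> t \<pi>"
      by (intro lim[of "max (length \<pi>) (Suc t)"] \<tau>(3)) auto
  qed
  moreover have "converges_globally \<tau> \<Gamma>"
    unfolding converges_globally_def by (intro ballI lim \<tau>(4))
  moreover have "converges_locally \<tau> \<Lambda>"
    unfolding converges_locally_def by (intro ballI lim \<tau>(5))
  ultimately show ?thesis by blast
qed

end
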